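(* Let $\mathcal{A}\subset\{0,1\}^{\mathbb{N}}$ be the squarefree flow, i.e. the set of all admissible sequences, with the left shift $\sigma:\mathcal{A}\to\mathcal{A}$. Then $(\mathcal{A},\sigma)$ possesses a unique measure of maximal entropy.
   Context: $\mathbb{N}=\{1,2,3,\dots\}$; $\Omega^{(2)}=\{0,1\}^{\mathbb{N}}$ carries the product topology, and $\sigma:\Omega^{(2)}\to\Omega^{(2)}$ is the left shift $(\sigma x)_n=x_{n+1}$. The support of $x=(x_n)\in\Omega^{(2)}$ is $\operatorname{supp}(x)=\{n\in\mathbb{N}: x_n=1\}$. A subset $A\subset\mathbb{N}$ is admissible if for every prime $p$ the reduction of $A$ modulo $p^2$ is a proper subset of $\mathbb{Z}/p^2\mathbb{Z}$; a sequence $x\in\Omega^{(2)}$ is admissible if $\operatorname{supp}(x)$ is admissible. $\mathcal{A}$ is the set of admissible sequences; it is a closed, shift-invariant subset of $\Omega^{(2)}$. (The squarefree flow is originally defined as the closure of the $\sigma$-orbit $\{\sigma^k(\mu^2): k\ge 0\}$ of the sequence $(\mu^2(n))_{n\ge1}$, where $\mu$ is the Möbius function; it is a known theorem of Sarnak that this closure equals $\mathcal{A}$.) A measure of maximal entropy is a $\sigma$-invariant Borel probability measure on $\mathcal{A}$ whose measure-theoretic entropy equals the topological entropy of $(\mathcal{A},\sigma)$. *)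

theory Defs
  imports
    "HOL-Probability.Probability"
    "HOL-Computational_Algebra.Primes"
begin

text \<open>Entropy, both topological and measure-theoretic, is taken with natural logarithms.\<close>

text \<open>The family \<open>C \<or> T\<^sup>-\<^sup>1C \<or> \<dots> \<or> T\<^sup>-\<^sup>(\<^sup>n\<^sup>-\<^sup>1\<^sup>)C\<close> of subsets of \<open>X\<close>.
  It may contain the empty set even if \<open>C\<close> does not; this affects neither minimal subcovers
  nor the entropy of a partition.\<close>

definition iterated_join :: "'a set \<Rightarrow> ('a \<Rightarrow> 'a) \<Rightarrow> 'a set set \<Rightarrow> nat \<Rightarrow> 'a set set" where
  "iterated_join X T C n = {X \<inter> (\<Inter>i<n. (T ^^ i) -` c i) | c. \<forall>i<n. c i \<in> C}"

definition open_cover :: "'a topology \<Rightarrow> 'a set set \<Rightarrow> bool" where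
  "open_cover X C \<longleftrightarrow> (\<forall>U\<in>C. openin X U) \<and> \<Union>C = topspace X"

definition min_subcover_card :: "'a set \<Rightarrow> 'a set set \<Rightarrow> nat" where
  "min_subcover_card X C = (LEAST k. \<exists>D\<subseteq>C. finite D \<and> card D = k \<and> X \<subseteq> \<Union>D)"

text \<open>The definition of Adler, Konheim and McAndrew, for a continuous self-map \<open>T\<close> of a compact
  space \<open>X\<close>; under these hypotheses the limit exists by subadditivity.\<close>

definition topological_entropy_cover :: "'a topology \<Rightarrow> ('a \<Rightarrow> 'a) \<Rightarrow> 'a set set \<Rightarrow> real" where
  "topological_entropy_cover X T C =
     lim (\<lambda>n. ln (real (min_subcover_card (topspace X) (iterated_join (topspace X) T C n))) / real n)"

definition topological_entropy :: "'a topology \<Rightarrow> ('a \<Rightarrow> 'a) \<Rightarrow> ereal" where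
  "topological_entropy X T = (SUP C\<in>{C. open_cover X C}. ereal (topological_entropy_cover X T C))"

definition finite_measurable_partition :: "'a measure \<Rightarrow> 'a set set \<Rightarrow> bool" where
  "finite_measurable_partition M P \<longleftrightarrow> finite P \<and> P \<subseteq> sets M \<and> partition_on (space M) P"

definition partition_entropy :: "'a measure \<Rightarrow> 'a set set \<Rightarrow> real" where
  "partition_entropy M P = - (\<Sum>A\<in>P. measure M A * ln (measure M A))"

text \<open>The Kolmogorov--Sinai entropy of a measure-preserving self-map \<open>T\<close> of a probability space;
  again the limit exists by subadditivity.\<close>

definition measure_entropy_partition :: "'a measure \<Rightarrow> ('a \<Rightarrow> 'a) \<Rightarrow> 'a set set \<Rightarrow> real" where
  "measure_entropy_partition M T P =
     lim (\<lambda>n. partition_entropy M (iterated_join (space M) T P n) / real n)"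

definition measure_entropy :: "'a measure \<Rightarrow> ('a \<Rightarrow> 'a) \<Rightarrow> ereal" where
  "measure_entropy M T =
     (SUP P\<in>{P. finite_measurable_partition M P}. ereal (measure_entropy_partition M T P))"

definition invariant_borel_prob :: "'a::topological_space set \<Rightarrow> ('a \<Rightarrow> 'a) \<Rightarrow> 'a measure \<Rightarrow> bool" where
  "invariant_borel_prob X T M \<longleftrightarrow>
     prob_space M \<and> sets M = sets (restrict_space borel X) \<and>
     T \<in> measurable M M \<and> distr M M T = M"

definition maximal_entropy_measure :: "'a::topological_space set \<Rightarrow> ('a \<Rightarrow> 'a) \<Rightarrow> 'a measure \<Rightarrow> bool" where
  "maximal_entropy_measure X T M \<longleftrightarrow>
     invariant_borel_prob X T M \<and> measure_entropy M T = topological_entropy (top_of_set X) T"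

text \<open>A point \<open>(x\<^sub>1, x\<^sub>2, \<dots>)\<close> of \<open>{0,1}\<^sup>\<nat>\<close>, indexed by the positive integers, is represented by a
  function \<open>x :: nat \<Rightarrow> bool\<close> with \<open>x n\<close> standing for the equation \<open>x\<^sub>n\<^sub>+\<^sub>1 = 1\<close>. The
  topology is the type-class topology on functions, i.e. the product of the discrete
  topologies.\<close>

definition left_shift :: "(nat \<Rightarrow> bool) \<Rightarrow> (nat \<Rightarrow> bool)" where
  "left_shift x = (\<lambda>n. x (Suc n))"

definition supp :: "(nat \<Rightarrow> bool) \<Rightarrow> nat set" where
  "supp x = {Suc n | n. x n}"

definition admissible :: "nat set \<Rightarrow> bool" where
  "admissible A \<longleftrightarrow> (\<forall>p. prime p \<longrightarrow> (\<lambda>n. n mod p\<^sup>2) ` A \<subset> {..<p\<^sup>2})"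

definition squarefree_flow :: "(nat \<Rightarrow> bool) set" where
  "squarefree_flow = {x. admissible (supp x)}"

end

theory Submission
  imports Defs "HOL-Number_Theory.Cong"
begin

text \<open>
  Write \<open>d\<^sub>K\<close> for the density of the integers divisible by no \<open>p\<^sup>2\<close> with \<open>p \<le> K\<close> prime, and \<open>d\<close> for the
  limit of \<open>d\<^sub>K\<close> as \<open>K\<close> grows. The topological entropy of the flow and the largest entropy of an
  invariant measure both equal \<open>d ln 2\<close>.

  The upper bound is a count of words. The support of an admissible sequence misses a class modulo
  \<open>p\<^sup>2\<close> for each \<open>p \<le> K\<close>, and by the Chinese remainder theorem these classes come from a single
  integer \<open>r\<close> modulo \<open>N = \<Prod> p\<^sup>2\<close>. A word of length \<open>n\<close> is therefore a subset of one of \<open>N\<close> sets with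
  about \<open>n d\<^sub>K\<close> elements, which leaves about \<open>N 2\<^sup>\<open>n d\<^sub>K\<close>\<close> words (\<open>ln_card_words_le\<close>).

  Uniqueness comes from testing the entropy of words against one family of codes. By Gibbs'
  inequality, entropy is at most the mean length of any code that obeys Kraft's inequality. Fix a
  finite set \<open>F\<close> of positions, and let \<open>m\<^sub>K\<close> be the probability that all of \<open>F\<close> carries ones when a random
  translate of the sieved set is chosen and then a uniformly random subset of it. Code a word by
  first naming the translate that contains it and then using the uniform distribution on its
  subsets, tilted by a factor \<open>e\<^sup>t\<close> for each occurrence of \<open>F\<close>. For an invariant measure \<open>M\<close> of entropy
  at least \<open>h\<close> and for \<open>F \<subseteq> {..<L}\<close>, comparing the mean code length with \<open>n h\<close> gives
  \<open>t M(F) \<le> L (d\<^sub>K ln 2 - h) + (e\<^sup>t - 1) m\<^sub>K\<close> for all real \<open>t\<close> (\<open>entropy_forces_pattern\<close>), where \<open>M(F)\<close> is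
  the probability that all of \<open>F\<close> carries ones. If \<open>h = d ln 2\<close>, then the first term vanishes as
  \<open>K\<close> grows, and small \<open>t\<close> of either sign give \<open>M(F) = lim m\<^sub>K\<close> (\<open>pattern_prob_limit\<close>). The limit does
  not mention \<open>M\<close>, and the events of this kind determine \<open>M\<close> (\<open>max_entropy_unique\<close>).

  For existence, choose a uniformly random class modulo \<open>p\<^sup>2\<close> for each prime, independently, and toss a
  fair coin at every position outside all chosen classes (\<open>sieved_law\<close>). If \<open>D\<close> is the set of such
  positions below \<open>n\<close> and \<open>V\<close> is the word of length \<open>n\<close>, then \<open>H(D, V) = H(D) + E|D| ln 2\<close>, and
  \<open>H(D, V) \<le> H(D) + H(V)\<close> leaves \<open>H(V) \<ge> E|D| ln 2 = n d ln 2\<close> (\<open>entropy_sieved_law\<close>).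

  These arguments concern the entropy of words. The entropy of a measure is a supremum over all
  finite measurable partitions; it agrees with the growth rate of the entropy of words because every
  such partition can be guessed from long words with small probability of error
  (\<open>measure_entropy_partition_le\<close>). Likewise a Lebesgue number argument bounds the entropy of every
  open cover by the growth rate of the number of words (\<open>join_subcover_by_words\<close>).
\<close>

section \<open>Entropy of simple random variables\<close>

text \<open>
  The quotients stay above their infimum \<open>l\<close>. If \<open>a m / m\<close> is close to \<open>l\<close>, division of \<open>n\<close> by \<open>m\<close> with
  remainder bounds \<open>a n / n\<close> by \<open>a m / m\<close> up to a term of order \<open>1 / n\<close>.
\<close>

lemma fekete:
  fixes a :: "nat \<Rightarrow> real"
  assumes sub: "\<And>m n. a (m + n) \<le> a m + a n" and nonneg: "\<And>n. 0 \<le> a n"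
  shows "(\<lambda>n. a n / real n) \<longlonglongrightarrow> lim (\<lambda>n. a n / real n)"
    and "n > 0 \<Longrightarrow> lim (\<lambda>n. a n / real n) \<le> a n / real n"
proof -
  define l where "l = (INF n\<in>{0<..}. a n / real n)"
  have bdd: "bdd_below ((\<lambda>n. a n / real n) ` {0<..})"
    by (intro bdd_belowI2[where m=0]) (simp add: nonneg)
  have lower: "l \<le> a n / real n" if "n > 0" for n
    unfolding l_def using that bdd by (intro cINF_lower) auto
  have mult: "a (q * m) \<le> real q * a m + a 0" for q m
  proof (induction q)
    case (Suc q)
    have "a (Suc q * m) \<le> a m + a (q * m)"
      using sub[of m "q * m"] by simp
    with Suc show ?case by (simp add: algebra_simps)
  qed simp
  have "(\<lambda>n. a n / real n) \<longlonglongrightarrow> l"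
  proof (rule LIMSEQ_I)
    fix r :: real assume r: "0 < r"
    have "\<exists>m\<in>{0<..}. a m / real m < l + r / 2"
      using r bdd by (subst cINF_less_iff[symmetric]) (auto simp: l_def)
    then obtain m where m: "m > 0" "a m / real m < l + r / 2" by auto
    define B where "B = a 0 + (\<Sum>i<m. a i)"
    have B: "0 \<le> B" by (simp add: B_def nonneg sum_nonneg)
    have bound: "a n / real n \<le> a m / real m + B / real n" if n: "n > 0" for n
    proof -
      have "a n \<le> a (n div m * m) + a (n mod m)"
        using sub[of "n div m * m" "n mod m"] by simp
      also have "a (n mod m) \<le> (\<Sum>i<m. a i)"
        using m(1) nonneg by (intro member_le_sum) auto
      also have "a (n div m * m) \<le> real (n div m) * a m + a 0" by (rule mult)
      also have "real (n div m) * a m \<le> real n / real m * a m"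
        by (intro mult_right_mono of_nat_div_le_of_nat nonneg)
      finally have "a n \<le> real n / real m * a m + B" by (simp add: B_def)
      then show ?thesis using n by (simp add: field_simps)
    qed
    obtain n0 :: nat where n0: "2 * B / r < real n0" using reals_Archimedean2 by blast
    show "\<exists>n0. \<forall>n\<ge>n0. norm (a n / real n - l) < r"
    proof (intro exI[of _ "Suc n0"] allI impI)
      fix n assume n: "Suc n0 \<le> n"
      then have "2 * B / r < real n" using n0 by linarith
      then have "B / real n < r / 2" using r n by (simp add: field_simps)
      with bound[of n] lower[of n] m(2) n show "norm (a n / real n - l) < r"
        unfolding real_norm_def by linarith
    qed
  qed
  then have "lim (\<lambda>n. a n / real n) = l" by (rule limI)
  with \<open>(\<lambda>n. a n / real n) \<longlonglongrightarrow> l\<close> lower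
  show "(\<lambda>n. a n / real n) \<longlonglongrightarrow> lim (\<lambda>n. a n / real n)"
    and "n > 0 \<Longrightarrow> lim (\<lambda>n. a n / real n) \<le> a n / real n" by auto
qed

definition fibre_prob :: "'a measure \<Rightarrow> ('a \<Rightarrow> 'b) \<Rightarrow> 'b \<Rightarrow> real" where
  "fibre_prob M f y = measure M {x \<in> space M. f x = y}"

text \<open>
  Values of probability zero are left out so that logarithms of probabilities obey the usual laws.
\<close>

definition atoms :: "'a measure \<Rightarrow> ('a \<Rightarrow> 'b) \<Rightarrow> 'b set" where
  "atoms M f = {y \<in> f ` space M. fibre_prob M f y > 0}"

definition entropy_of :: "'a measure \<Rightarrow> ('a \<Rightarrow> 'b) \<Rightarrow> real" where
  "entropy_of M f = - (\<Sum>y\<in>atoms M f. fibre_prob M f y * ln (fibre_prob M f y))"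

lemma simple_function_fibre:
  assumes "simple_function M f"
  shows "{x \<in> space M. f x = y} \<in> sets M"
proof -
  have "{x \<in> space M. f x = y} = f -` {y} \<inter> space M" by auto
  with simple_functionD(2)[OF assms] show ?thesis by simp
qed

lemma finite_atoms: "simple_function M f \<Longrightarrow> finite (atoms M f)"
  by (rule finite_subset[of _ "f ` space M"]) (auto simp: atoms_def simple_functionD(1))

lemma fibre_prob_nonneg: "0 \<le> fibre_prob M f y"
  by (simp add: fibre_prob_def)

context prob_space
begin

lemma fibre_prob_le_1: "fibre_prob M f y \<le> 1"
  by (simp add: fibre_prob_def)

lemma expectation_simple:
  fixes \<phi> :: "'b \<Rightarrow> real"
  assumes f: "simple_function M f"
  shows "integrable M (\<lambda>x. \<phi> (f x))"
    and "(\<integral>x. \<phi> (f x) \<partial>M) = (\<Sum>y\<in>atoms M f. fibre_prob M f y * \<phi> y)"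
proof -
  have fin: "finite (f ` space M)" using f by (rule simple_functionD)
  let ?g = "\<lambda>x. \<Sum>y\<in>f ` space M. \<phi> y * indicator {x \<in> space M. f x = y} x"
  have eq: "?g x = \<phi> (f x)" if x: "x \<in> space M" for x
  proof -
    have "?g x = (\<Sum>y\<in>f ` space M. if y = f x then \<phi> y else 0)"
      using x by (intro sum.cong) (auto simp: indicator_def)
    also have "\<dots> = \<phi> (f x)" using x fin by (simp add: sum.delta)
    finally show ?thesis .
  qed
  have int: "integrable M (indicator {x \<in> space M. f x = y} :: 'a \<Rightarrow> real)" for y
    by (intro integrable_real_indicator simple_function_fibre f) (simp add: less_top[symmetric])
  then have "integrable M ?g"
    by (intro Bochner_Integration.integrable_sum integrable_mult_right)
  then show "integrable M (\<lambda>x. \<phi> (f x))"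
    by (rule Bochner_Integration.integrable_cong[THEN iffD1, rotated -1]) (auto simp: eq)
  have "(\<integral>x. \<phi> (f x) \<partial>M) = (\<integral>x. ?g x \<partial>M)"
    by (intro Bochner_Integration.integral_cong) (auto simp: eq)
  also have "\<dots> = (\<Sum>y\<in>f ` space M. fibre_prob M f y * \<phi> y)"
    by (subst Bochner_Integration.integral_sum) (auto simp: fibre_prob_def mult.commute int Int_absorb2 intro!: sum.cong)
  also have "\<dots> = (\<Sum>y\<in>atoms M f. fibre_prob M f y * \<phi> y)"
    using fin by (intro sum.mono_neutral_right)
      (auto simp: atoms_def fibre_prob_nonneg order_less_le)
  finally show "(\<integral>x. \<phi> (f x) \<partial>M) = (\<Sum>y\<in>atoms M f. fibre_prob M f y * \<phi> y)" .
qed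

lemma sum_fibre_prob: "simple_function M f \<Longrightarrow> (\<Sum>y\<in>atoms M f. fibre_prob M f y) = 1"
  using expectation_simple(2)[of f "\<lambda>_. 1"] by (simp add: prob_space)

lemma entropy_of_eq_expectation:
  assumes "simple_function M f"
  shows "entropy_of M f = (\<integral>x. - ln (fibre_prob M f (f x)) \<partial>M)"
  using expectation_simple(2)[OF assms, of "\<lambda>y. - ln (fibre_prob M f y)"]
  by (simp add: entropy_of_def sum_negf)

lemma entropy_of_nonneg: "0 \<le> entropy_of M f"
  unfolding entropy_of_def sum_negf[symmetric]
  using fibre_prob_le_1 by (intro sum_nonneg) (auto simp: atoms_def intro!: mult_nonneg_nonpos)

text \<open>
  Gibbs' inequality in the language of codes: if the lengths \<open>\<phi>\<close> obey Kraft's inequality, then their mean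
  is at least the entropy. The pointwise reason is \<open>ln x \<le> x - 1\<close> at the ratio of \<open>exp (- \<phi> y)\<close> to the
  probability of \<open>y\<close>. Every upper bound for an entropy below is obtained from a suitable \<open>\<phi>\<close>.
\<close>

lemma gibbs_inequality:
  fixes \<phi> :: "'b \<Rightarrow> real"
  assumes f: "simple_function M f" and \<phi>: "(\<Sum>y\<in>atoms M f. exp (- \<phi> y)) \<le> 1"
  shows "entropy_of M f \<le> (\<integral>x. \<phi> (f x) \<partial>M)"
proof -
  have "- (p * ln p) \<le> p * \<phi> y + exp (- \<phi> y) - p"
    if "p = fibre_prob M f y" "y \<in> atoms M f" for p y
  proof -
    have p: "p > 0" using that by (simp add: atoms_def)
    have "ln (exp (- \<phi> y) / p) \<le> exp (- \<phi> y) / p - 1"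
      using p by (intro ln_le_minus_one) simp
    then have "p * (- \<phi> y - ln p) \<le> p * (exp (- \<phi> y) / p - 1)"
      using p by (simp add: ln_div)
    then show ?thesis using p by (simp add: algebra_simps)
  qed
  then have "(\<Sum>y\<in>atoms M f. - (fibre_prob M f y * ln (fibre_prob M f y)))
      \<le> (\<Sum>y\<in>atoms M f. fibre_prob M f y * \<phi> y + exp (- \<phi> y) - fibre_prob M f y)"
    by (intro sum_mono) simp
  also have "\<dots> = (\<integral>x. \<phi> (f x) \<partial>M) + (\<Sum>y\<in>atoms M f. exp (- \<phi> y)) - 1"
    using f by (simp add: sum.distrib sum_subtractf expectation_simple(2) sum_fibre_prob)
  finally show ?thesis using \<phi> by (simp add: entropy_of_def sum_negf)
qed

lemma entropy_of_le_ln_card: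
  assumes f: "simple_function M f" and sub: "atoms M f \<subseteq> A" and A: "finite A"
  shows "entropy_of M f \<le> ln (card A)"
proof -
  have ne: "atoms M f \<noteq> {}" using sum_fibre_prob[OF f] by auto
  then have "card A > 0" using sub A by (auto simp: card_gt_0_iff)
  moreover have "card (atoms M f) \<le> card A" using sub A by (rule card_mono[rotated])
  ultimately have "entropy_of M f \<le> (\<integral>x. ln (card A) \<partial>M)"
    by (intro gibbs_inequality[OF f]) (simp add: exp_minus field_simps)
  then show ?thesis by (simp add: prob_space)
qed

text \<open>
  The fibres of \<open>g\<close> refine those of \<open>f\<close>, so they have smaller probability and longer ideal code words.
\<close>

lemma entropy_of_function_le:
  assumes g: "simple_function M g" and f: "simple_function M f"
    and h: "\<And>x. x \<in> space M \<Longrightarrow> f x = h (g x)"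
  shows "entropy_of M f \<le> entropy_of M g"
proof -
  have "entropy_of M f = (\<integral>x. - ln (fibre_prob M f (h (g x))) \<partial>M)"
    unfolding entropy_of_eq_expectation[OF f]
    by (intro Bochner_Integration.integral_cong) (auto simp: h)
  also have "\<dots> = (\<Sum>y\<in>atoms M g. fibre_prob M g y * - ln (fibre_prob M f (h y)))"
    by (rule expectation_simple(2)[OF g])
  also have "\<dots> \<le> (\<Sum>y\<in>atoms M g. fibre_prob M g y * - ln (fibre_prob M g y))"
  proof (intro sum_mono mult_left_mono)
    fix y assume y: "y \<in> atoms M g"
    have "fibre_prob M g y \<le> fibre_prob M f (h y)"
      unfolding fibre_prob_def
      by (intro finite_measure_mono simple_function_fibre f) (auto simp: h)
    then show "- ln (fibre_prob M f (h y)) \<le> - ln (fibre_prob M g y)"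
      using y by (simp add: atoms_def)
  qed (rule fibre_prob_nonneg)
  also have "\<dots> = entropy_of M g" by (simp add: entropy_of_def sum_negf)
  finally show ?thesis .
qed

text \<open>
  Once \<open>f\<close> is known, \<open>u\<close> is coded with the help of the guess \<open>b (f x)\<close>, where \<open>k a c\<close> is the length of the
  code word for the value \<open>a\<close> under the guess \<open>c\<close>. Appending this to the ideal code for \<open>f\<close> codes the pair.
  This plays the part of a bound on conditional entropy.
\<close>

lemma entropy_of_pair_le:
  fixes k :: "'c \<Rightarrow> 'd \<Rightarrow> real"
  assumes f: "simple_function M f" and u: "simple_function M u"
    and k: "\<And>y. y \<in> atoms M f \<Longrightarrow> (\<Sum>a\<in>atoms M u. exp (- k a (b y))) \<le> 1"
  shows "entropy_of M (\<lambda>x. (f x, u x)) \<le> entropy_of M f + (\<integral>x. k (u x) (b (f x)) \<partial>M)"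
proof -
  have fu: "simple_function M (\<lambda>x. (f x, u x))" by (intro simple_function_Pair f u)
  have sub: "atoms M (\<lambda>x. (f x, u x)) \<subseteq> atoms M f \<times> atoms M u"
  proof safe
    fix y a assume ya: "(y, a) \<in> atoms M (\<lambda>x. (f x, u x))"
    have "fibre_prob M (\<lambda>x. (f x, u x)) (y, a) \<le> fibre_prob M f y"
      "fibre_prob M (\<lambda>x. (f x, u x)) (y, a) \<le> fibre_prob M u a"
      unfolding fibre_prob_def
      by (intro finite_measure_mono simple_function_fibre f u; auto)+
    with ya show "y \<in> atoms M f" "a \<in> atoms M u" by (auto simp: atoms_def)
  qed
  define \<phi> where "\<phi> = (\<lambda>(y, a). - ln (fibre_prob M f y) + k a (b y))"
  have "(\<Sum>z\<in>atoms M (\<lambda>x. (f x, u x)). exp (- \<phi> z)) \<le> (\<Sum>z\<in>atoms M f \<times> atoms M u. exp (- \<phi> z))"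
    using sub f u by (intro sum_mono2 finite_cartesian_product finite_atoms) auto
  also have "\<dots> = (\<Sum>y\<in>atoms M f. fibre_prob M f y * (\<Sum>a\<in>atoms M u. exp (- k a (b y))))"
    unfolding sum.cartesian_product[symmetric]
    by (subst sum.cartesian_product')
      (auto intro!: sum.cong simp: \<phi>_def sum_distrib_left exp_diff exp_minus atoms_def field_simps)
  also have "\<dots> \<le> (\<Sum>y\<in>atoms M f. fibre_prob M f y * 1)"
    by (intro sum_mono mult_left_mono k fibre_prob_nonneg)
  also have "\<dots> = 1" by (simp add: sum_fibre_prob f)
  finally have "entropy_of M (\<lambda>x. (f x, u x)) \<le> (\<integral>x. \<phi> (f x, u x) \<partial>M)"
    by (rule gibbs_inequality[OF fu])
  also have "\<dots> = (\<integral>x. - ln (fibre_prob M f (f x)) + k (u x) (b (f x)) \<partial>M)"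
    by (simp add: \<phi>_def)
  also have "\<dots> = entropy_of M f + (\<integral>x. k (u x) (b (f x)) \<partial>M)"
    unfolding entropy_of_eq_expectation[OF f]
    using expectation_simple(1)[OF f, of "\<lambda>y. - ln (fibre_prob M f y)"]
      expectation_simple(1)[OF fu, of "\<lambda>(y, a). k a (b y)"]
    by (subst Bochner_Integration.integral_add) auto
  finally show ?thesis .
qed

lemma entropy_of_pair_subadditive:
  assumes f: "simple_function M f" and u: "simple_function M u"
  shows "entropy_of M (\<lambda>x. (f x, u x)) \<le> entropy_of M f + entropy_of M u"
proof -
  have "(\<Sum>a\<in>atoms M u. exp (- (- ln (fibre_prob M u a)))) = (\<Sum>a\<in>atoms M u. fibre_prob M u a)"
    by (intro sum.cong) (auto simp: atoms_def)
  then show ?thesis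
    using entropy_of_pair_le[OF f u, of "\<lambda>a _. - ln (fibre_prob M u a)" "\<lambda>y. y"] u
    by (simp add: sum_fibre_prob entropy_of_eq_expectation[OF u])
qed

end

lemma entropy_of_distr:
  assumes T: "T \<in> measurable M N" and f: "simple_function N f"
  shows "entropy_of (distr M N T) f = entropy_of M (\<lambda>x. f (T x))"
proof -
  have "fibre_prob (distr M N T) f y = fibre_prob M (\<lambda>x. f (T x)) y" for y
    unfolding fibre_prob_def using simple_function_fibre[OF f, of y] T
    by (subst measure_distr) (auto intro!: arg_cong[where f="measure M"] dest: measurable_space)
  moreover have "atoms (distr M N T) f = atoms M (\<lambda>x. f (T x))"
    unfolding atoms_def calculation
  proof safe
    fix y x assume x: "x \<in> space (distr M N T)" and p: "0 < fibre_prob M (\<lambda>x. f (T x)) (f x)"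
    have "{z \<in> space M. f (T z) = f x} \<noteq> {}"
    proof
      assume "{z \<in> space M. f (T z) = f x} = {}"
      with p show False unfolding fibre_prob_def by (metis measure_empty less_irrefl)
    qed
    then show "f x \<in> (\<lambda>x. f (T x)) ` space M" by force
  qed (use T in \<open>auto dest: measurable_space\<close>)
  ultimately show ?thesis by (simp add: entropy_of_def)
qed

section \<open>Sieving out one residue class modulo each square\<close>

lemma periodic_sum:
  fixes \<phi> :: "nat \<Rightarrow> real"
  assumes per: "\<And>i. \<phi> (i + N) = \<phi> i"
  shows "(\<Sum>i<k * N. \<phi> (i + a)) = real k * (\<Sum>i<N. \<phi> i)"
proof -
  have shift: "(\<Sum>i<N. \<phi> (i + a)) = (\<Sum>i<N. \<phi> i)" for a
  proof (induction a)
    case (Suc a)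
    have "(\<Sum>i<N. \<phi> (i + Suc a)) + \<phi> a = (\<Sum>i<Suc N. \<phi> (i + a))"
      by (subst sum.lessThan_Suc_shift) simp
    also have "\<dots> = (\<Sum>i<N. \<phi> (i + a)) + \<phi> a"
      using per[of a] by (simp add: add.commute)
    finally show ?case using Suc by simp
  qed simp
  have "(\<Sum>i<k * N. \<phi> (i + a)) = (\<Sum>m<k. \<Sum>i\<in>{m * N..<m * N + N}. \<phi> (i + a))"
    by (rule sum.nat_group[symmetric])
  also have "\<dots> = (\<Sum>m<k. \<Sum>i<N. \<phi> (i + (m * N + a)))"
  proof (rule sum.cong[OF refl])
    fix m
    show "(\<Sum>i\<in>{m * N..<m * N + N}. \<phi> (i + a)) = (\<Sum>i<N. \<phi> (i + (m * N + a)))"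
      using sum.shift_bounds_nat_ivl[of "\<lambda>i. \<phi> (i + a)" 0 "m * N" N]
      by (simp add: lessThan_atLeast0 ac_simps)
  qed
  also have "\<dots> = real k * (\<Sum>i<N. \<phi> i)" by (simp add: shift)
  finally show ?thesis .
qed

definition period :: "nat \<Rightarrow> nat" where
  "period K = (\<Prod>p | prime p \<and> p \<le> K. p\<^sup>2)"

text \<open>
  One class modulo each \<open>p\<^sup>2\<close> is removed. That a single integer \<open>r\<close> names all the classes loses nothing,
  by the Chinese remainder theorem (\<open>sieve_residues\<close>), and it turns sieved sets into translates of each other.
\<close>

definition sieve :: "nat \<Rightarrow> nat \<Rightarrow> nat set" where
  "sieve K r = {i. \<forall>p. prime p \<and> p \<le> K \<longrightarrow> i mod p\<^sup>2 \<noteq> r mod p\<^sup>2}"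

text \<open>
  The density of the integers \<open>i\<close> for which the translate of \<open>F\<close> by \<open>i\<close> survives the sieve; the case
  \<open>F = {0}\<close> is the density of the sieved set itself.
\<close>

definition pattern_density :: "nat \<Rightarrow> nat set \<Rightarrow> real" where
  "pattern_density K F = (\<Sum>i<period K. of_bool ((+) i ` F \<subseteq> sieve K 0)) / real (period K)"

lemma period_pos: "period K > 0"
  unfolding period_def by (intro prod_pos) (auto simp: prime_gt_0_nat)

lemma mod_add_period:
  assumes "prime p" "p \<le> K"
  shows "(i + period K) mod p\<^sup>2 = i mod p\<^sup>2"
proof -
  have "p\<^sup>2 dvd period K"
    unfolding period_def using assms by (intro dvd_prodI) auto
  then show ?thesis by (auto simp: mod_add_right_eq[symmetric])
qed

lemma sieve_shift: "i + s \<in> sieve K (r + s) \<longleftrightarrow> i \<in> sieve K r"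
proof -
  have "(i + s) mod p\<^sup>2 = (r + s) mod p\<^sup>2 \<longleftrightarrow> i mod p\<^sup>2 = r mod p\<^sup>2" for p
    using cong_add_rcancel_nat[of i s r "p\<^sup>2"] by (simp add: cong_def)
  then show ?thesis by (simp add: sieve_def)
qed

lemma sieve_add_period_left: "i + period K \<in> sieve K r \<longleftrightarrow> i \<in> sieve K r"
  by (auto simp: sieve_def mod_add_period)

lemma sieve_add_period_right: "sieve K (r + period K) = sieve K r"
  by (auto simp: sieve_def mod_add_period)

lemma sieve_mod_period: "sieve K (r mod period K) = sieve K r"
proof -
  have "sieve K (r mod period K + q * period K) = sieve K (r mod period K)" for q
  proof (induction q)
    case (Suc q)
    have "r mod period K + Suc q * period K = r mod period K + q * period K + period K" by simp
    with Suc show ?case by (simp only: sieve_add_period_right)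
  qed simp
  from this[of "r div period K"] show ?thesis by simp
qed

text \<open>
  Whole periods can be counted from any starting point, and \<open>sieve K r\<close> is a translate of
  \<open>sieve K 0\<close>; so the count depends neither on \<open>r\<close> nor on which periods are taken.
\<close>

lemma pattern_count:
  "(\<Sum>i<k * period K. of_bool ((+) i ` F \<subseteq> sieve K r)) = real (k * period K) * pattern_density K F"
proof -
  define s where "s = period K - r mod period K"
  have s: "r mod period K + s = 0 + period K"
    using mod_less_divisor[OF period_pos, of r K] unfolding s_def by linarith
  have shift: "(+) i ` F \<subseteq> sieve K r \<longleftrightarrow> (+) (i + s) ` F \<subseteq> sieve K 0" for i
  proof -
    have "i + j \<in> sieve K r \<longleftrightarrow> (i + s) + j \<in> sieve K 0" for j
      using sieve_shift[of "i + j" s K "r mod period K"]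
      unfolding s sieve_add_period_right sieve_mod_period by (simp add: ac_simps)
    then show ?thesis by auto
  qed
  have per: "(+) (i + period K) ` F \<subseteq> sieve K 0 \<longleftrightarrow> (+) i ` F \<subseteq> sieve K 0" for i
  proof -
    have "i + period K + j \<in> sieve K 0 \<longleftrightarrow> i + j \<in> sieve K 0" for j
      using sieve_add_period_left[of "i + j" K 0] by (simp add: ac_simps)
    then show ?thesis by auto
  qed
  have "(\<Sum>i<k * period K. of_bool ((+) i ` F \<subseteq> sieve K r) :: real)
      = real k * (\<Sum>i<period K. of_bool ((+) i ` F \<subseteq> sieve K 0))"
    unfolding shift by (rule periodic_sum) (simp add: per)
  then show ?thesis using period_pos[of K] by (simp add: pattern_density_def)
qed

lemma pattern_density_bounds: "0 \<le> pattern_density K F" "pattern_density K F \<le> 1"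
proof -
  have "(\<Sum>i<period K. of_bool ((+) i ` F \<subseteq> sieve K 0) :: real) \<le> (\<Sum>i<period K. 1)"
    by (intro sum_mono) simp
  then show "pattern_density K F \<le> 1" using period_pos[of K] by (simp add: pattern_density_def)
qed (simp add: pattern_density_def sum_nonneg)

lemma card_sieve_le:
  "real (card (sieve K r \<inter> {..<n})) \<le> real n * pattern_density K {0} + real (period K)"
proof -
  let ?N = "period K" and ?k = "n div period K + 1"
  have "n < ?k * ?N"
    using period_pos[of K] by (metis add.commute dividend_less_times_div mult.commute mult_Suc_right plus_1_eq_Suc)
  then have "real (card (sieve K r \<inter> {..<n})) \<le> real (card (sieve K r \<inter> {..<?k * ?N}))"
    by (intro of_nat_mono card_mono) auto
  also have "\<dots> = (\<Sum>i<?k * ?N. of_bool ((+) i ` {0} \<subseteq> sieve K r))"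
    by (simp add: sum.If_cases of_bool_def Int_commute)
  also have "\<dots> = real (?k * ?N) * pattern_density K {0}"
    by (rule pattern_count)
  also have "\<dots> \<le> (real n + real ?N) * pattern_density K {0}"
  proof (intro mult_right_mono pattern_density_bounds)
    have "n div ?N * ?N \<le> n" by simp
    then show "real (?k * ?N) \<le> real n + real ?N"
      unfolding of_nat_add[symmetric] of_nat_le_iff by (simp add: algebra_simps)
  qed
  also have "\<dots> \<le> real n * pattern_density K {0} + real ?N"
    using mult_left_le[OF pattern_density_bounds(2), of "real ?N" K "{0}"] by (simp add: algebra_simps)
  finally show ?thesis .
qed

lemma sieve_residues:
  fixes \<rho> :: "nat \<Rightarrow> nat"
  shows "\<exists>r<period K. sieve K r = {i. \<forall>p. prime p \<and> p \<le> K \<longrightarrow> i mod p\<^sup>2 \<noteq> \<rho> p mod p\<^sup>2}"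
proof -
  have "\<exists>r. \<forall>p\<in>{p. prime p \<and> p \<le> K}. [r = \<rho> p] (mod p\<^sup>2)"
    by (intro chinese_remainder_nat) (auto intro: primes_coprime)
  then obtain r where "\<forall>p\<in>{p. prime p \<and> p \<le> K}. [r = \<rho> p] (mod p\<^sup>2)" by blast
  then have "sieve K (r mod period K) = {i. \<forall>p. prime p \<and> p \<le> K \<longrightarrow> i mod p\<^sup>2 \<noteq> \<rho> p mod p\<^sup>2}"
    unfolding sieve_mod_period by (auto simp: sieve_def cong_def)
  then show ?thesis using period_pos mod_less_divisor by blast
qed

text \<open>
  Positions start at \<open>0\<close> and the elements of the support at \<open>1\<close>, so a class missed by the support is
  moved back by one.
\<close>

lemma squarefree_flow_residue:
  "x \<in> squarefree_flow \<longleftrightarrow> (\<exists>\<rho>. \<forall>p i. prime p \<longrightarrow> x i \<longrightarrow> i mod p\<^sup>2 \<noteq> \<rho> p mod p\<^sup>2)"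
proof
  assume x: "x \<in> squarefree_flow"
  have "\<exists>b. \<forall>i. x i \<longrightarrow> i mod p\<^sup>2 \<noteq> b mod p\<^sup>2" if p: "prime p" for p
  proof -
    have "p\<^sup>2 > 0" using p by (simp add: prime_gt_0_nat)
    have "(\<lambda>n. n mod p\<^sup>2) ` supp x \<subset> {..<p\<^sup>2}"
      using x p by (auto simp: squarefree_flow_def admissible_def)
    then obtain b where b: "b < p\<^sup>2" "b \<notin> (\<lambda>n. n mod p\<^sup>2) ` supp x" by blast
    (* the class b of the support is the class b - 1 of positions; p^2 - 1 stands for -1 *)
    have "i mod p\<^sup>2 \<noteq> (b + (p\<^sup>2 - 1)) mod p\<^sup>2" if "x i" for i
    proof
      assume "i mod p\<^sup>2 = (b + (p\<^sup>2 - 1)) mod p\<^sup>2"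
      then have "Suc i mod p\<^sup>2 = Suc (b + (p\<^sup>2 - 1)) mod p\<^sup>2"
        by (metis mod_Suc_eq)
      also have "Suc (b + (p\<^sup>2 - 1)) = b + p\<^sup>2" using \<open>p\<^sup>2 > 0\<close> by simp
      also have "(b + p\<^sup>2) mod p\<^sup>2 = b" using b(1) by simp
      finally show False using b(2) that by (force simp: supp_def)
    qed
    then show ?thesis by blast
  qed
  then show "\<exists>\<rho>. \<forall>p i. prime p \<longrightarrow> x i \<longrightarrow> i mod p\<^sup>2 \<noteq> \<rho> p mod p\<^sup>2" by metis
next
  assume "\<exists>\<rho>. \<forall>p i. prime p \<longrightarrow> x i \<longrightarrow> i mod p\<^sup>2 \<noteq> \<rho> p mod p\<^sup>2"
  then obtain \<rho> where \<rho>: "\<And>p i. prime p \<Longrightarrow> x i \<Longrightarrow> i mod p\<^sup>2 \<noteq> \<rho> p mod p\<^sup>2" by blast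
  have "(\<lambda>n. n mod p\<^sup>2) ` supp x \<subset> {..<p\<^sup>2}" if p: "prime p" for p
  proof
    have p0: "p\<^sup>2 > 0" using p by (simp add: prime_gt_0_nat)
    then show "(\<lambda>n. n mod p\<^sup>2) ` supp x \<subseteq> {..<p\<^sup>2}" by auto
    have "Suc (\<rho> p) mod p\<^sup>2 \<notin> (\<lambda>n. n mod p\<^sup>2) ` supp x"
    proof
      assume "Suc (\<rho> p) mod p\<^sup>2 \<in> (\<lambda>n. n mod p\<^sup>2) ` supp x"
      then obtain i where i: "x i" "Suc i mod p\<^sup>2 = Suc (\<rho> p) mod p\<^sup>2" by (auto simp: supp_def)
      then have "i mod p\<^sup>2 = \<rho> p mod p\<^sup>2"
        using cong_add_rcancel_nat[of i 1 "\<rho> p" "p\<^sup>2"] by (simp add: cong_def)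
      with \<rho>[OF p i(1)] show False by simp
    qed
    then show "(\<lambda>n. n mod p\<^sup>2) ` supp x \<noteq> {..<p\<^sup>2}" using p0 by (metis lessThan_iff mod_less_divisor)
  qed
  then show "x \<in> squarefree_flow" by (simp add: squarefree_flow_def admissible_def)
qed

definition word :: "nat \<Rightarrow> (nat \<Rightarrow> bool) \<Rightarrow> nat set" where
  "word n x = {i. i < n \<and> x i}"

lemma word_prefix: "n \<le> N \<Longrightarrow> word N x \<inter> {..<n} = word n x"
  by (auto simp: word_def)

lemma word_sieved:
  assumes "x \<in> squarefree_flow"
  shows "\<exists>r<period K. word n x \<subseteq> sieve K r \<inter> {..<n}"
proof -
  obtain \<rho> where \<rho>: "\<And>p i. prime p \<Longrightarrow> x i \<Longrightarrow> i mod p\<^sup>2 \<noteq> \<rho> p mod p\<^sup>2"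
    using assms by (auto simp: squarefree_flow_residue)
  obtain r where "r < period K" "sieve K r = {i. \<forall>p. prime p \<and> p \<le> K \<longrightarrow> i mod p\<^sup>2 \<noteq> \<rho> p mod p\<^sup>2}"
    using sieve_residues by blast
  then show ?thesis using \<rho> by (intro exI[of _ r]) (auto simp: word_def)
qed

lemma finite_words: "finite (word n ` X)"
  by (rule finite_subset[of _ "Pow {..<n}"]) (auto simp: word_def)

lemma ln_card_words_le:
  "ln (card (word n ` squarefree_flow))
    \<le> ln (period K) + (real n * pattern_density K {0} + real (period K)) * ln 2"
proof -
  let ?B = "real n * pattern_density K {0} + real (period K)"
  have "word n ` squarefree_flow \<subseteq> (\<Union>r<period K. Pow (sieve K r \<inter> {..<n}))"
    using word_sieved by blast
  then have "card (word n ` squarefree_flow) \<le> card (\<Union>r<period K. Pow (sieve K r \<inter> {..<n}))"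
    by (intro card_mono) auto
  also have "\<dots> \<le> (\<Sum>r<period K. card (Pow (sieve K r \<inter> {..<n})))"
    by (rule card_UN_le) simp
  finally have "real (card (word n ` squarefree_flow)) \<le> (\<Sum>r<period K. 2 ^ card (sieve K r \<inter> {..<n}))"
    by (simp add: card_Pow del: Pow_Int_eq flip: of_nat_le_iff[where 'a=real])
  also have "\<dots> \<le> (\<Sum>r<period K. 2 powr ?B)"
    using card_sieve_le[of K _ n] by (intro sum_mono) (simp add: powr_realpow[symmetric])
  also have "\<dots> = period K * 2 powr ?B" by simp
  finally have le: "real (card (word n ` squarefree_flow)) \<le> period K * 2 powr ?B" .
  have "(\<lambda>_. False) \<in> squarefree_flow" by (simp add: squarefree_flow_residue)
  then have "card (word n ` squarefree_flow) > 0"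
    by (auto simp: card_gt_0_iff finite_words)
  then have "ln (card (word n ` squarefree_flow)) \<le> ln (period K * 2 powr ?B)"
    using le period_pos[of K] by (subst ln_le_cancel_iff) auto
  also have "\<dots> = ln (period K) + ?B * ln 2"
    using period_pos[of K] by (simp add: ln_mult ln_powr)
  finally show ?thesis .
qed

section \<open>Entropy forces pattern frequencies\<close>

lemma sum_of_bool_superset:
  assumes "finite D" "finite U"
  shows "(\<Sum>w\<in>Pow D. of_bool (U \<subseteq> w) :: real) = 2 ^ card D * (if U \<subseteq> D then 1 / 2 ^ card U else 0)"
proof (cases "U \<subseteq> D")
  case True
  have "{w \<in> Pow D. U \<subseteq> w} = (\<lambda>v. v \<union> U) ` Pow (D - U)"
  proof (intro equalityI subsetI)
    fix w assume "w \<in> {w \<in> Pow D. U \<subseteq> w}"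
    then have "w = (w - U) \<union> U" "w - U \<in> Pow (D - U)" by auto
    then show "w \<in> (\<lambda>v. v \<union> U) ` Pow (D - U)" by blast
  qed (use True in auto)
  moreover have "inj_on (\<lambda>v. v \<union> U) (Pow (D - U))" by (auto simp: inj_on_def)
  ultimately have "card {w \<in> Pow D. U \<subseteq> w} = 2 ^ (card D - card U)"
    using assms True by (simp add: card_image card_Pow card_Diff_subset)
  then have "real (card {w \<in> Pow D. U \<subseteq> w}) = 2 ^ (card D - card U)" by simp
  moreover have "card U \<le> card D" using assms True by (simp add: card_mono)
  moreover have "(\<Sum>w\<in>Pow D. of_bool (U \<subseteq> w) :: real) = real (card {w \<in> Pow D. U \<subseteq> w})"
    using assms by (simp add: of_bool_def sum.If_cases Int_def)
  ultimately show ?thesis using True by (simp add: power_diff)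
next
  case False
  then have "of_bool (U \<subseteq> w) = (0::real)" if "w \<in> Pow D" for w using that by auto
  then have "(\<Sum>w\<in>Pow D. of_bool (U \<subseteq> w) :: real) = 0" by (intro sum.neutral) auto
  then show ?thesis using False by simp
qed

text \<open>
  For a uniformly random subset \<open>w\<close> of \<open>D\<close>, the events \<open>G j \<subseteq> w\<close> with disjoint \<open>G j\<close> are independent, and so the
  exponential moment of their number factorises. The proof expands the product over \<open>J\<close> into a sum over
  subsets \<open>X\<close> of \<open>J\<close> and counts the sets \<open>w\<close> that contain the union of the \<open>G j\<close> with \<open>j \<in> X\<close>.
\<close>

lemma sum_tilted_subsets:
  fixes a :: real
  assumes D: "finite D" and J: "finite J" and G: "\<And>j. j \<in> J \<Longrightarrow> finite (G j)"
    and disj: "disjoint_family_on G J"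
  shows "(\<Sum>w\<in>Pow D. \<Prod>j\<in>J. if G j \<subseteq> w then a else 1)
    = 2 ^ card D * (\<Prod>j\<in>J. 1 + (a - 1) * (if G j \<subseteq> D then 1 / 2 ^ card (G j) else 0))"
proof -
  have fin: "finite X" if "X \<in> Pow J" for X using that J finite_subset by blast
  have "(\<Sum>w\<in>Pow D. \<Prod>j\<in>J. if G j \<subseteq> w then a else 1)
      = (\<Sum>w\<in>Pow D. \<Prod>j\<in>J. (a - 1) * of_bool (G j \<subseteq> w) + 1)"
    by (intro sum.cong prod.cong) auto
  also have "\<dots> = (\<Sum>w\<in>Pow D. \<Sum>X\<in>Pow J. (a - 1) ^ card X * of_bool (\<Union> (G ` X) \<subseteq> w))"
  proof (intro sum.cong refl)
    fix w
    have "(\<Prod>j\<in>X. (a - 1) * of_bool (G j \<subseteq> w)) = (a - 1) ^ card X * of_bool (\<Union> (G ` X) \<subseteq> w)"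
      if "X \<in> Pow J" for X
    proof (cases "\<Union> (G ` X) \<subseteq> w")
      case False
      then obtain j where "j \<in> X" "\<not> G j \<subseteq> w" by blast
      then have "(\<Prod>j\<in>X. (a - 1) * of_bool (G j \<subseteq> w)) = 0" using fin[OF that] by (intro prod_zero) auto
      then show ?thesis using False by simp
    qed (auto simp: prod_constant UN_subset_iff)
    then show "(\<Prod>j\<in>J. (a - 1) * of_bool (G j \<subseteq> w) + 1)
        = (\<Sum>X\<in>Pow J. (a - 1) ^ card X * of_bool (\<Union> (G ` X) \<subseteq> w))"
      by (subst prod_add[OF J]) (auto intro!: sum.cong)
  qed
  also have "\<dots> = (\<Sum>X\<in>Pow J. (a - 1) ^ card X * (\<Sum>w\<in>Pow D. of_bool (\<Union> (G ` X) \<subseteq> w)))"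
    by (subst sum.swap) (simp add: sum_distrib_left)
  also have "\<dots> = (\<Sum>X\<in>Pow J. 2 ^ card D * (\<Prod>j\<in>X. (a - 1) * (if G j \<subseteq> D then 1 / 2 ^ card (G j) else 0)))"
  proof (intro sum.cong refl)
    fix X assume X: "X \<in> Pow J"
    have fG: "finite (\<Union> (G ` X))" using X fin[OF X] G by auto
    have "(if \<Union> (G ` X) \<subseteq> D then 1 / 2 ^ card (\<Union> (G ` X)) else 0)
        = (\<Prod>j\<in>X. if G j \<subseteq> D then 1 / 2 ^ card (G j) else 0 :: real)"
    proof (cases "\<Union> (G ` X) \<subseteq> D")
      case True
      have "card (\<Union> (G ` X)) = (\<Sum>j\<in>X. card (G j))"
      proof (intro card_UN_disjoint ballI impI)
        fix i j assume "i \<in> X" "j \<in> X" "i \<noteq> j"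
        then show "G i \<inter> G j = {}" using X disj unfolding disjoint_family_on_def by blast
      qed (use X G fin[OF X] in auto)
      then have "2 ^ card (\<Union> (G ` X)) = (\<Prod>j\<in>X. 2 ^ card (G j) :: real)"
        by (simp add: power_sum)
      moreover have "(\<Prod>j\<in>X. if G j \<subseteq> D then 1 / 2 ^ card (G j) else 0 :: real) = (\<Prod>j\<in>X. 1 / 2 ^ card (G j))"
        using True by (intro prod.cong) auto
      ultimately show ?thesis using True by (simp add: prod_dividef)
    next
      case False
      then obtain j where "j \<in> X" "\<not> G j \<subseteq> D" by blast
      then have "(\<Prod>j\<in>X. if G j \<subseteq> D then 1 / 2 ^ card (G j) else 0 :: real) = 0"
        using fin[OF X] by (intro prod_zero) auto
      then show ?thesis using False by simp
    qed
    then show "(a - 1) ^ card X * (\<Sum>w\<in>Pow D. of_bool (\<Union> (G ` X) \<subseteq> w))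
        = 2 ^ card D * (\<Prod>j\<in>X. (a - 1) * (if G j \<subseteq> D then 1 / 2 ^ card (G j) else 0))"
      using sum_of_bool_superset[OF D fG] by (simp add: prod.distrib)
  qed
  also have "\<dots> = 2 ^ card D * (\<Prod>j\<in>J. (a - 1) * (if G j \<subseteq> D then 1 / 2 ^ card (G j) else 0) + 1)"
    by (subst prod_add[OF J]) (simp add: sum_distrib_left)
  finally show ?thesis by (simp add: add.commute)
qed

text \<open>
  The negative logarithm of the following weight of \<open>w\<close>: one of \<open>N\<close> translates is chosen uniformly, and
  then the subset \<open>w\<close> of the chosen set \<open>D\<close> has weight proportional to \<open>e\<^sup>t\<close> to the number of \<open>i \<in> J\<close> with
  \<open>G i \<subseteq> w\<close>. In the exact normalising constant a factor \<open>1 + (e\<^sup>t - 1) u\<close> would stand for each \<open>i \<in> J\<close>,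
  with \<open>u\<close> the probability of \<open>G i \<subseteq> w\<close>; it is replaced by the larger number \<open>exp ((e\<^sup>t - 1) u)\<close>.
\<close>

definition tilted_code_length ::
    "real \<Rightarrow> nat \<Rightarrow> nat set \<Rightarrow> (nat \<Rightarrow> nat set) \<Rightarrow> nat set \<Rightarrow> nat set \<Rightarrow> real" where
  "tilted_code_length t N D G J w = ln N + card D * ln 2
     + (\<Sum>i\<in>J. (exp t - 1) * (if G i \<subseteq> D then 1 / 2 ^ card (G i) else 0))
     - t * (\<Sum>i\<in>J. of_bool (G i \<subseteq> w))"

lemma kraft_tilted:
  assumes D: "finite D" and J: "finite J" and G: "\<And>j. j \<in> J \<Longrightarrow> finite (G j)"
    and disj: "disjoint_family_on G J" and N: "N > 0"
  shows "(\<Sum>w\<in>Pow D. exp (- tilted_code_length t N D G J w)) \<le> 1 / N"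
proof -
  define u :: "nat \<Rightarrow> real" where "u i = (if G i \<subseteq> D then 1 / 2 ^ card (G i) else 0)" for i
  have u: "0 \<le> u i" "u i \<le> 1" for i by (auto simp: u_def)
  have eq: "exp (- tilted_code_length t N D G J w)
      = 1 / N / 2 ^ card D / exp (\<Sum>i\<in>J. (exp t - 1) * u i) * (\<Prod>j\<in>J. if G j \<subseteq> w then exp t else 1)" for w
  proof -
    have "exp (t * (\<Sum>i\<in>J. of_bool (G i \<subseteq> w))) = (\<Prod>j\<in>J. if G j \<subseteq> w then exp t else 1)"
      unfolding sum_distrib_left exp_sum[OF J] by (intro prod.cong) auto
    moreover have "exp (card D * ln 2) = (2::real) ^ card D"
      by (simp add: exp_of_nat_mult)
    ultimately show ?thesis using N
      by (simp add: tilted_code_length_def u_def exp_minus exp_add exp_diff field_simps)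
  qed
  have "(\<Sum>w\<in>Pow D. exp (- tilted_code_length t N D G J w))
      = 1 / N / 2 ^ card D / exp (\<Sum>i\<in>J. (exp t - 1) * u i) * (\<Sum>w\<in>Pow D. \<Prod>j\<in>J. if G j \<subseteq> w then exp t else 1)"
    unfolding eq by (rule sum_distrib_left[symmetric])
  also have "\<dots> = 1 / N / exp (\<Sum>i\<in>J. (exp t - 1) * u i) * (\<Prod>j\<in>J. 1 + (exp t - 1) * u j)"
    by (subst sum_tilted_subsets[OF D J _ disj]) (auto simp: u_def G)
  also have "\<dots> \<le> 1 / N / exp (\<Sum>i\<in>J. (exp t - 1) * u i) * (\<Prod>j\<in>J. exp ((exp t - 1) * u j))"
  proof (intro mult_left_mono prod_mono conjI)
    fix j
    have "(1 - u j) + exp t * u j \<ge> 0" using u[of j] by (intro add_nonneg_nonneg) auto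
    then show "0 \<le> 1 + (exp t - 1) * u j" by (simp add: algebra_simps)
  qed (auto intro: exp_ge_add_one_self)
  also have "\<dots> = 1 / N" by (simp add: exp_sum J)
  finally show ?thesis .
qed

text \<open>
  The code of \<open>tilted_code_length\<close> is applied to words of length \<open>n + L\<close>. Occurrences \<open>i + F\<close> of the pattern
  can overlap, whereas the code wants disjoint sets; therefore the positions \<open>i < n\<close> are split by their
  residue \<open>c\<close> modulo \<open>L\<close>, which makes the translates of \<open>F \<subseteq> {..<L}\<close> within one class disjoint. The \<open>L\<close>
  resulting bounds are added, so that every position \<open>i < n\<close> is counted exactly once. For \<open>n\<close> equal to \<open>k\<close>
  periods, both densities on the right appear up to an error that does not grow with \<open>k\<close>; division by \<open>n\<close>
  removes it.
\<close>

lemma (in prob_space) entropy_forces_pattern: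
  fixes T :: "'a \<Rightarrow> nat \<Rightarrow> bool"
  assumes flow: "\<And>x. x \<in> space M \<Longrightarrow> T x \<in> squarefree_flow"
    and simple: "\<And>n. simple_function M (\<lambda>x. word n (T x))"
    and stationary: "\<And>i. prob {x \<in> space M. \<forall>j\<in>F. T x (i + j)} = prob {x \<in> space M. \<forall>j\<in>F. T x j}"
    and entropy: "\<And>n. real n * h \<le> entropy_of M (\<lambda>x. word n (T x))"
    and F: "F \<subseteq> {..<L}" "L > 0"
  shows "t * prob {x \<in> space M. \<forall>j\<in>F. T x j}
    \<le> L * (pattern_density K {0} * ln 2 - h) + (exp t - 1) * (pattern_density K F / 2 ^ card F)"
proof -
  let ?N = "period K" and ?d = "pattern_density K {0}" and ?m = "pattern_density K F / 2 ^ card F"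
  let ?P = "prob {x \<in> space M. \<forall>j\<in>F. T x j}"
  define G where "G i = (+) i ` F" for i
  have finF: "finite F" using F finite_subset by blast
  have G: "finite (G i)" "card (G i) = card F" for i
    using finF by (auto simp: G_def card_image)
  (* the part of the bound for n = k * ?N that does not grow with k *)
  define C where "C = L * ln ?N + L * (real L * ?d + ?N) * ln 2 - real L * L * h"
  have main: "real k * (?N * (t * ?P - L * (?d * ln 2 - h) - (exp t - 1) * ?m)) \<le> C" for k
  proof -
    define n where "n = k * ?N"
    let ?w = "\<lambda>x. word (n + L) (T x)"
    define D where "D r = sieve K r \<inter> {..<n + L}" for r
    (* a translate of the sieved set that contains the word w; it is part of the code for w *)
    define r where "r w = (SOME r. r < ?N \<and> w \<subseteq> D r)" for w
    define J where "J c = {i. i < n \<and> i mod L = c}" for c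
    let ?\<phi> = "\<lambda>c r w. tilted_code_length t ?N (D r) G (J c) w"
    have finD: "finite (D r)" and finJ: "finite (J c)" for r c by (auto simp: D_def J_def)
    have r: "r w < ?N \<and> w \<subseteq> D (r w)" if w: "w \<in> atoms M ?w" for w
    proof -
      obtain x where "x \<in> space M" "w = ?w x" using w unfolding atoms_def by blast
      then have "\<exists>r. r < ?N \<and> w \<subseteq> D r"
        using word_sieved[OF flow, of x K "n + L"] by (auto simp: D_def)
      then show ?thesis unfolding r_def by (rule someI_ex)
    qed
    have disj: "disjoint_family_on G (J c)" for c
      unfolding disjoint_family_on_def
    proof (intro ballI impI)
      fix i i' assume i: "i \<in> J c" "i' \<in> J c" "i \<noteq> i'"
      have "i + j \<noteq> i' + j'" if j: "j \<in> F" "j' \<in> F" for j j'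
      proof
        assume eq: "i + j = i' + j'"
        have jL: "j < L" "j' < L" using j F by auto
        have "i mod L = c" "i' mod L = c" using i by (auto simp: J_def)
        then have "i = i div L * L + c" "i' = i' div L * L + c" by (metis div_mult_mod_eq)+
        then have eq': "i div L * L + j = i' div L * L + j'" using eq by linarith
        have "i div L = (i div L * L + j) div L" "i' div L = (i' div L * L + j') div L"
          using jL by simp_all
        then have "i div L = i' div L" using eq' by simp
        with \<open>i = i div L * L + c\<close> \<open>i' = i' div L * L + c\<close> i(3) show False by metis
      qed
      then show "G i \<inter> G i' = {}" by (auto simp: G_def)
    qed
    have kraft: "(\<Sum>w\<in>atoms M ?w. exp (- ?\<phi> c (r w) w)) \<le> 1" for c
    proof -
      have "(\<Sum>w\<in>atoms M ?w. exp (- ?\<phi> c (r w) w))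
          \<le> (\<Sum>w\<in>atoms M ?w. \<Sum>r<?N. of_bool (w \<subseteq> D r) * exp (- ?\<phi> c r w))"
      proof (intro sum_mono)
        fix w assume "w \<in> atoms M ?w"
        then have "exp (- ?\<phi> c (r w) w) = of_bool (w \<subseteq> D (r w)) * exp (- ?\<phi> c (r w) w)" "r w < ?N"
          using r by auto
        then show "exp (- ?\<phi> c (r w) w) \<le> (\<Sum>r<?N. of_bool (w \<subseteq> D r) * exp (- ?\<phi> c r w))"
          using member_le_sum[of "r w" "{..<?N}" "\<lambda>r. of_bool (w \<subseteq> D r) * exp (- ?\<phi> c r w)"] by auto
      qed
      also have "\<dots> = (\<Sum>r<?N. \<Sum>w\<in>atoms M ?w \<inter> Pow (D r). exp (- ?\<phi> c r w))"
        by (subst sum.swap)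
          (auto simp: of_bool_def sum.inter_restrict finite_atoms simple if_distrib[of "\<lambda>x. x * _"] cong: if_cong)
      also have "\<dots> \<le> (\<Sum>r<?N. \<Sum>w\<in>Pow (D r). exp (- ?\<phi> c r w))"
        by (intro sum_mono sum_mono2) (auto simp: finD)
      also have "\<dots> \<le> (\<Sum>r<?N. 1 / real ?N)"
        by (intro sum_mono kraft_tilted finD finJ G disj period_pos)
      also have "\<dots> = 1" using period_pos[of K] by simp
      finally show ?thesis .
    qed
    have pointwise: "(\<Sum>c<L. ?\<phi> c (r w) w)
        \<le> L * ln ?N + L * ((real n + L) * ?d + ?N) * ln 2 + (exp t - 1) * (n * ?m) - t * (\<Sum>i<n. of_bool (G i \<subseteq> w))"
      if w: "w \<in> atoms M ?w" for w
    proof -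
      (* the classes modulo L partition the positions below n *)
      have split: "(\<Sum>c<L. \<Sum>i\<in>J c. g i) = (\<Sum>i<n. g i)" for g :: "nat \<Rightarrow> real"
        using sum.group[of "{..<n}" "{..<L}" "\<lambda>i. i mod L" g] F(2)
        by (simp add: J_def image_subset_iff)
      have inD: "G i \<subseteq> D s \<longleftrightarrow> (+) i ` F \<subseteq> sieve K s" if "i < n" for i s
        using F that by (force simp: G_def D_def)
      have "(\<Sum>i<n. if G i \<subseteq> D (r w) then 1 / 2 ^ card (G i) else 0 :: real)
          = (\<Sum>i<n. of_bool ((+) i ` F \<subseteq> sieve K (r w))) / 2 ^ card F"
        unfolding sum_divide_distrib by (intro sum.cong) (auto simp: inD G)
      also have "\<dots> = n * ?m" unfolding n_def pattern_count by simp
      finally have m: "(\<Sum>i<n. if G i \<subseteq> D (r w) then 1 / 2 ^ card (G i) else 0 :: real) = n * ?m" .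
      have "(\<Sum>c<L. ?\<phi> c (r w) w) = L * ln ?N + L * (card (D (r w)) * ln 2)
          + (exp t - 1) * (n * ?m) - t * (\<Sum>i<n. of_bool (G i \<subseteq> w))"
        unfolding tilted_code_length_def sum.distrib sum_subtractf sum_distrib_left[symmetric] split m
        by simp
      moreover have "real (card (D (r w))) * ln 2 \<le> ((real n + L) * ?d + ?N) * ln 2"
        using card_sieve_le[of K "r w" "n + L"] unfolding D_def
        by (intro mult_right_mono) (simp_all add: of_nat_add)
      then have "L * (real (card (D (r w))) * ln 2) \<le> L * (((real n + L) * ?d + ?N) * ln 2)"
        by (intro mult_left_mono) auto
      ultimately show ?thesis by (simp add: mult.assoc)
    qed
    have "real L * (real (n + L) * h) \<le> (\<Sum>c<L. \<integral>x. ?\<phi> c (r (?w x)) (?w x) \<partial>M)"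
    proof -
      have "real (n + L) * h \<le> (\<integral>x. ?\<phi> c (r (?w x)) (?w x) \<partial>M)" for c
        using entropy[of "n + L"] gibbs_inequality[OF simple kraft[of c]] by linarith
      then have "(\<Sum>c<L. real (n + L) * h) \<le> (\<Sum>c<L. \<integral>x. ?\<phi> c (r (?w x)) (?w x) \<partial>M)"
        by (intro sum_mono)
      then show ?thesis by simp
    qed
    also have "\<dots> = (\<integral>x. (\<Sum>c<L. ?\<phi> c (r (?w x)) (?w x)) \<partial>M)"
      by (rule Bochner_Integration.integral_sum[symmetric])
        (rule expectation_simple(1)[OF simple, of "\<lambda>w. ?\<phi> _ (r w) w"])
    also have "\<dots> = (\<Sum>w\<in>atoms M ?w. fibre_prob M ?w w * (\<Sum>c<L. ?\<phi> c (r w) w))"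
      by (rule expectation_simple(2)[OF simple])
    also have "\<dots> \<le> (\<Sum>w\<in>atoms M ?w. fibre_prob M ?w w *
        (L * ln ?N + L * ((real n + L) * ?d + ?N) * ln 2 + (exp t - 1) * (n * ?m) - t * (\<Sum>i<n. of_bool (G i \<subseteq> w))))"
      by (intro sum_mono mult_left_mono pointwise fibre_prob_nonneg)
    also have "\<dots> = (L * ln ?N + L * ((real n + L) * ?d + ?N) * ln 2 + (exp t - 1) * (n * ?m))
        - t * (\<Sum>i<n. \<Sum>w\<in>atoms M ?w. fibre_prob M ?w w * of_bool (G i \<subseteq> w))"
    proof -
      have "(\<Sum>w\<in>atoms M ?w. fibre_prob M ?w w * (A - t * B w))
          = A - t * (\<Sum>w\<in>atoms M ?w. fibre_prob M ?w w * B w)" for A B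
        by (simp add: right_diff_distrib sum_subtractf sum_distrib_right[symmetric]
            sum_fibre_prob simple sum_distrib_left mult.left_commute)
      moreover have "(\<Sum>i<n. \<Sum>w\<in>atoms M ?w. fibre_prob M ?w w * of_bool (G i \<subseteq> w))
          = (\<Sum>w\<in>atoms M ?w. fibre_prob M ?w w * (\<Sum>i<n. of_bool (G i \<subseteq> w)))"
        by (subst sum.swap) (simp only: sum_distrib_left)
      ultimately show ?thesis by simp
    qed
    also have "(\<Sum>i<n. \<Sum>w\<in>atoms M ?w. fibre_prob M ?w w * of_bool (G i \<subseteq> w)) = (\<Sum>i<n. ?P)"
    proof (intro sum.cong refl)
      fix i assume i: "i \<in> {..<n}"
      have eq: "G i \<subseteq> ?w x \<longleftrightarrow> (\<forall>j\<in>F. T x (i + j))" for x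
        using F i by (force simp: G_def word_def)
      have "(\<Sum>w\<in>atoms M ?w. fibre_prob M ?w w * of_bool (G i \<subseteq> w)) = (\<integral>x. of_bool (G i \<subseteq> ?w x) \<partial>M)"
        by (rule expectation_simple(2)[OF simple, symmetric])
      also have "\<dots> = (\<integral>x. indicator {x \<in> space M. \<forall>j\<in>F. T x (i + j)} x \<partial>M)"
        by (intro Bochner_Integration.integral_cong) (auto simp: eq indicator_def)
      also have "\<dots> = ?P" using stationary by (simp add: Int_absorb2)
      finally show "(\<Sum>w\<in>atoms M ?w. fibre_prob M ?w w * of_bool (G i \<subseteq> w)) = ?P" .
    qed
    finally show ?thesis unfolding C_def n_def by (simp add: algebra_simps)
  qed
  have "?N * (t * ?P - L * (?d * ln 2 - h) - (exp t - 1) * ?m) \<le> 0"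
  proof (rule ccontr)
    assume "\<not> ?N * (t * ?P - L * (?d * ln 2 - h) - (exp t - 1) * ?m) \<le> 0"
    then obtain k where "C < real k * (?N * (t * ?P - L * (?d * ln 2 - h) - (exp t - 1) * ?m))"
      using reals_Archimedean3[of "?N * (t * ?P - L * (?d * ln 2 - h) - (exp t - 1) * ?m)"] by auto
    with main[of k] show False by linarith
  qed
  then have "t * ?P - L * (?d * ln 2 - h) - (exp t - 1) * ?m \<le> 0"
    using period_pos[of K] by (simp add: mult_le_0_iff)
  then show ?thesis by simp
qed

section \<open>Itineraries, partitions and words\<close>

definition names :: "('a \<Rightarrow> 'a) \<Rightarrow> ('a \<Rightarrow> 'b) \<Rightarrow> nat \<Rightarrow> 'a \<Rightarrow> 'b list" where
  "names T l n x = map (\<lambda>i. l ((T ^^ i) x)) [0..<n]"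

lemma names_Suc: "names T l (Suc n) x = names T l n x @ [l ((T ^^ n) x)]"
  by (simp add: names_def)

lemma names_add: "names T l (m + n) x = names T l m x @ names T l n ((T ^^ m) x)"
proof (induction n)
  case (Suc n)
  have "(T ^^ (m + n)) x = (T ^^ n) ((T ^^ m) x)" by (metis add.commute comp_apply funpow_add)
  with Suc show ?case by (simp only: add_Suc_right names_Suc append_assoc)
qed (simp add: names_def)

lemma simple_function_measurable_comp:
  assumes "simple_function N f" "T \<in> measurable M N"
  shows "simple_function M (\<lambda>x. f (T x))"
proof -
  have "finite ((\<lambda>x. f (T x)) ` space M)"
    by (rule finite_subset[of _ "f ` space N"])
      (use assms in \<open>auto simp: simple_functionD dest: measurable_space\<close>)
  moreover have "(\<lambda>x. f (T x)) -` {y} \<inter> space M \<in> sets M" for y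
  proof -
    have "(\<lambda>x. f (T x)) -` {y} \<inter> space M = T -` (f -` {y} \<inter> space N) \<inter> space M"
      using assms(2) by (auto dest: measurable_space)
    then show ?thesis using measurable_sets[OF assms(2) simple_functionD(2)[OF assms(1)]] by simp
  qed
  ultimately show ?thesis unfolding simple_function_def by blast
qed

lemma measure_preserving_funpow:
  assumes "T \<in> measurable M M" "distr M M T = M"
  shows "T ^^ n \<in> measurable M M" "distr M M (T ^^ n) = M"
proof -
  show meas: "T ^^ n \<in> measurable M M" for n
  proof (induction n)
    case (Suc n)
    show ?case using measurable_comp[OF Suc assms(1)] by (simp add: o_def)
  qed (simp add: id_def)
  show "distr M M (T ^^ n) = M"
  proof (induction n)
    case (Suc n)
    have "distr M M (T ^^ Suc n) = distr (distr M M (T ^^ n)) M T"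
      using assms(1) meas by (subst distr_distr) (auto simp: o_def)
    with Suc assms(2) show ?case by (simp add: o_def)
  qed (simp add: id_def distr_id2)
qed

lemma simple_function_names:
  assumes T: "T \<in> measurable M M" and l: "simple_function M l"
  shows "simple_function M (names T l n)"
proof (induction n)
  case (Suc n)
  have "T ^^ n \<in> measurable M M"
  proof (induction n)
    case (Suc n)
    show ?case using measurable_comp[OF Suc T] by (simp add: o_def)
  qed (simp add: id_def)
  then have "simple_function M (\<lambda>x. l ((T ^^ n) x))"
    using l by (rule simple_function_measurable_comp[rotated])
  with Suc have "simple_function M (\<lambda>x. (\<lambda>(y, a). y @ [a]) (names T l n x, l ((T ^^ n) x)))"
    by (intro simple_function_compose1[of M _ "\<lambda>(y, a). y @ [a]"] simple_function_Pair)
  then show ?case by (simp add: names_Suc[abs_def])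
qed (simp add: names_def simple_function_const)

definition part_of :: "'a set set \<Rightarrow> 'a \<Rightarrow> 'a set" where
  "part_of P x = (THE A. A \<in> P \<and> x \<in> A)"

lemma part_of:
  assumes "partition_on X P" "x \<in> X"
  shows "part_of P x \<in> P" "B \<in> P \<Longrightarrow> part_of P x = B \<longleftrightarrow> x \<in> B"
proof -
  obtain A where A: "A \<in> P" "x \<in> A"
    using assms unfolding partition_on_def by blast
  have unique: "B = A" if "B \<in> P" "x \<in> B" for B
    using disjointD[OF partition_onD2[OF assms(1)] that(1) A(1)] A(2) that(2) by blast
  have "part_of P x = A"
    unfolding part_of_def by (rule the_equality) (use A unique in blast)+
  note eq = this
  show "part_of P x \<in> P" unfolding eq by (rule A(1))
  show "part_of P x = B \<longleftrightarrow> x \<in> B" if "B \<in> P"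
    unfolding eq using A(2) unique[OF that] by blast
qed

lemma simple_function_part_of:
  assumes P: "finite_measurable_partition M P"
  shows "simple_function M (part_of P)"
proof -
  have P': "finite P" "P \<subseteq> sets M" "partition_on (space M) P"
    using P by (auto simp: finite_measurable_partition_def)
  have "part_of P -` {part_of P x} \<inter> space M \<in> sets M" if "x \<in> space M" for x
  proof -
    have "part_of P -` {part_of P x} \<inter> space M = part_of P x \<inter> space M"
      using part_of[OF P'(3)] that by blast
    then show ?thesis using part_of(1)[OF P'(3) that] P'(2) by auto
  qed
  moreover have "finite (part_of P ` space M)"
    using P'(1) by (rule finite_subset[rotated]) (auto simp: part_of(1)[OF P'(3)])
  ultimately show ?thesis by (auto simp: simple_function_def)
qed

text \<open>
  The nonempty cells of the join are exactly the fibres of the itinerary, and distinct itineraries have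
  distinct fibres. An empty cell contributes \<open>0 * ln 0 = 0\<close>.
\<close>

lemma partition_entropy_join:
  assumes P: "finite_measurable_partition M P" and T: "T \<in> measurable M M"
  shows "partition_entropy M (iterated_join (space M) T P n) = entropy_of M (names T (part_of P) n)"
proof -
  let ?f = "names T (part_of P) n" and ?C = "iterated_join (space M) T P n"
  let ?fib = "\<lambda>y. {x \<in> space M. ?f x = y}"
  let ?h = "\<lambda>A. measure M A * ln (measure M A)"
  have P': "finite P" "partition_on (space M) P"
    using P by (auto simp: finite_measurable_partition_def)
  have Tn: "(T ^^ i) x \<in> space M" if "x \<in> space M" for i x
    by (induction i) (use that measurable_space[OF T] in auto)
  have simple: "simple_function M ?f"
    by (intro simple_function_names T simple_function_part_of P)
  have cell: "space M \<inter> (\<Inter>i<n. (T ^^ i) -` c i) = ?fib (map c [0..<n])" if "\<forall>i<n. c i \<in> P" for c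
  proof (intro set_eqI)
    fix x
    have "(T ^^ i) x \<in> c i \<longleftrightarrow> part_of P ((T ^^ i) x) = c i" if "x \<in> space M" "i < n" for i
      using part_of(2)[OF P'(2) Tn[OF that(1)], of "c i" i] that \<open>\<forall>i<n. c i \<in> P\<close> by simp
    then have "x \<in> space M \<and> (\<forall>i\<in>{..<n}. (T ^^ i) x \<in> c i)
        \<longleftrightarrow> x \<in> space M \<and> (\<forall>i\<in>{..<n}. part_of P ((T ^^ i) x) = c i)" by blast
    then show "x \<in> space M \<inter> (\<Inter>i<n. (T ^^ i) -` c i) \<longleftrightarrow> x \<in> ?fib (map c [0..<n])"
      by (simp add: names_def atLeast0LessThan)
  qed
  have C: "?C = ?fib ` {map c [0..<n] |c. \<forall>i<n. c i \<in> P}"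
  proof (intro equalityI subsetI)
    fix A assume "A \<in> ?C"
    then obtain c where c: "\<forall>i<n. c i \<in> P" "A = space M \<inter> (\<Inter>i<n. (T ^^ i) -` c i)"
      by (auto simp: iterated_join_def)
    then show "A \<in> ?fib ` {map c [0..<n] |c. \<forall>i<n. c i \<in> P}" using cell[of c] by blast
  next
    fix A assume "A \<in> ?fib ` {map c [0..<n] |c. \<forall>i<n. c i \<in> P}"
    then obtain c where c: "\<forall>i<n. c i \<in> P" "A = ?fib (map c [0..<n])" by blast
    then show "A \<in> ?C" using cell[of c] unfolding iterated_join_def by blast
  qed
  have in_C: "?fib (?f x) \<in> ?C" if "x \<in> space M" for x
    unfolding C using part_of(1)[OF P'(2) Tn[OF that]]
    by (intro imageI CollectI exI[of _ "\<lambda>i. part_of P ((T ^^ i) x)"]) (simp add: names_def)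
  have finC: "finite ?C"
  proof -
    have "{map c [0..<n] |c. \<forall>i<n. c i \<in> P} \<subseteq> {xs. set xs \<subseteq> P \<and> length xs = n}" by auto
    then show ?thesis unfolding C
      using finite_lists_length_eq[OF P'(1)] finite_subset by (intro finite_imageI) blast
  qed
  have "(\<Sum>A\<in>?C. ?h A) = (\<Sum>A\<in>?fib ` atoms M ?f. ?h A)"
  proof (intro sum.mono_neutral_right finC ballI)
    show "?fib ` atoms M ?f \<subseteq> ?C" using in_C by (auto simp: atoms_def)
    fix A assume A: "A \<in> ?C - ?fib ` atoms M ?f"
    then obtain y where y: "A = ?fib y" unfolding C by blast
    show "?h A = 0"
    proof (cases "A = {}")
      case False
      then have "y \<in> ?f ` space M" using y by auto
      then have "fibre_prob M ?f y = 0"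
        using A y fibre_prob_nonneg[of M ?f y] by (auto simp: atoms_def)
      then show ?thesis by (simp add: y fibre_prob_def)
    qed simp
  qed
  also have "\<dots> = (\<Sum>y\<in>atoms M ?f. ?h (?fib y))"
    by (intro sum.reindex_cong[of ?fib]) (auto simp: inj_on_def atoms_def)
  finally show ?thesis by (simp add: partition_entropy_def entropy_of_def fibre_prob_def)
qed

context prob_space
begin

lemma entropy_of_shifted:
  assumes "T \<in> measurable M M" "distr M M T = M" "simple_function M f"
  shows "entropy_of M (\<lambda>x. f ((T ^^ m) x)) = entropy_of M f"
  using entropy_of_distr[OF measure_preserving_funpow(1)[OF assms(1,2)] assms(3), of m]
  by (simp add: measure_preserving_funpow(2)[OF assms(1,2)])

lemma entropy_of_names_add:
  assumes T: "T \<in> measurable M M" "distr M M T = M" and l: "simple_function M l"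
  shows "entropy_of M (names T l (m + n)) \<le> entropy_of M (names T l m) + entropy_of M (names T l n)"
proof -
  note simple = simple_function_names[OF T(1) l]
  note Tm = simple_function_measurable_comp[OF simple measure_preserving_funpow(1)[OF T]]
  have "entropy_of M (names T l (m + n)) \<le> entropy_of M (\<lambda>x. (names T l m x, names T l n ((T ^^ m) x)))"
    by (rule entropy_of_function_le[where h="\<lambda>(y, z). y @ z"])
      (auto intro!: simple_function_Pair simple Tm simp: names_add)
  also have "\<dots> \<le> entropy_of M (names T l m) + entropy_of M (\<lambda>x. names T l n ((T ^^ m) x))"
    by (intro entropy_of_pair_subadditive simple Tm)
  finally show ?thesis by (simp add: entropy_of_shifted[OF T simple])
qed

text \<open>
  Fekete's lemma guarantees that the limit in the definition exists.
\<close>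

lemma measure_entropy_partition_names:
  assumes T: "T \<in> measurable M M" "distr M M T = M" and P: "finite_measurable_partition M P"
  shows "(\<lambda>n. entropy_of M (names T (part_of P) n) / n) \<longlonglongrightarrow> measure_entropy_partition M T P"
  unfolding measure_entropy_partition_def partition_entropy_join[OF P T(1)]
  by (intro fekete(1) entropy_of_names_add T simple_function_part_of P entropy_of_nonneg)

end

lemma funpow_left_shift: "(left_shift ^^ m) x = (\<lambda>n. x (m + n))"
  by (induction m arbitrary: x) (auto simp: left_shift_def funpow_swap1)

lemma word_eq_iff: "word n x = word n y \<longleftrightarrow> (\<forall>i<n. x i = y i)"
  by (auto simp: word_def)

lemma open_contains_cylinder:
  fixes U :: "(nat \<Rightarrow> bool) set"
  assumes "open U" "x \<in> U"
  shows "\<exists>n. \<forall>y. word n y = word n x \<longrightarrow> y \<in> U"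
proof -
  obtain X where X: "x \<in> Pi\<^sub>E UNIV X" "finite {i. X i \<noteq> UNIV}" "Pi\<^sub>E UNIV X \<subseteq> U"
    using product_topology_open_contains_basis[of "\<lambda>_. euclidean" UNIV U x] assms
    unfolding open_fun_def by auto
  obtain n where n: "{i. X i \<noteq> UNIV} \<subseteq> {..<n}"
    using finite_nat_iff_bounded X(2) by blast
  have "y \<in> U" if "word n y = word n x" for y
  proof -
    have "y i \<in> X i" for i
    proof (cases "i < n")
      case True
      then show ?thesis using that X(1) by (auto simp: word_eq_iff PiE_iff)
    next
      case False
      then have "X i = UNIV" using n by auto
      then show ?thesis by simp
    qed
    then show ?thesis using X(3) by (auto simp: PiE_iff)
  qed
  then show ?thesis by blast
qed

lemma open_pattern: "finite F \<Longrightarrow> open {x :: nat \<Rightarrow> bool. \<forall>j\<in>F. x j}"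
proof -
  assume "finite F"
  then have "open {x :: nat \<Rightarrow> bool. \<forall>j\<in>F. x j \<in> {True}}"
    by (rule product_topology_basis'[of F "\<lambda>_. {True}" "\<lambda>j. j"]) (rule discrete_topology_class.open_discrete)
  then show ?thesis by simp
qed

text \<open>
  An open set is the union of the cylinders contained in it, of which there are countably many, and a
  cylinder is a Boolean combination of finitely many sets \<open>{x. x j}\<close>.
\<close>

lemma sets_borel_patterns:
  "sets (borel :: (nat \<Rightarrow> bool) measure) = sigma_sets UNIV {{x. \<forall>j\<in>F. x j} | F. finite F}"
    (is "_ = sigma_sets _ ?G")
proof
  let ?S = "sigma UNIV ?G"
  have S: "sets ?S = sigma_sets UNIV ?G" by (simp add: sets_measure_of)
  have [measurable]: "Measurable.pred ?S (\<lambda>x. x j)" for j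
  proof -
    have "{x. \<forall>j\<in>{j}. x j} \<in> ?G" by blast
    then have "{x. x j} \<in> sigma_sets UNIV ?G" by (auto intro: sigma_sets.Basic)
    then show ?thesis by (simp add: pred_def S space_measure_of_conv)
  qed
  have "U \<in> sets ?S" if U: "open U" for U
  proof -
    let ?I = "{(n, w). w \<in> Pow {..<n} \<and> {x. word n x = w} \<subseteq> U}"
    have "{x. word n x = w} \<in> sets ?S" if "w \<subseteq> {..<n}" for n w
    proof -
      have "{x. word n x = w} = {x \<in> space ?S. \<forall>i\<in>{..<n}. x i = (i \<in> w)}"
        using that by (auto simp: word_def space_measure_of_conv)
      also have "\<dots> \<in> sets ?S" by measurable
      finally show ?thesis .
    qed
    moreover have "countable ?I"
      by (rule countable_subset[of _ "Sigma UNIV (\<lambda>n. Pow {..<n})"])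
        (auto intro: countable_finite)
    ultimately have "(\<Union>(n, w)\<in>?I. {x. word n x = w}) \<in> sets ?S"
      by (intro sets.countable_UN'') auto
    also have "(\<Union>(n, w)\<in>?I. {x. word n x = w}) = U"
    proof (intro equalityI subsetI)
      fix x assume "x \<in> U"
      then obtain n where "\<forall>y. word n y = word n x \<longrightarrow> y \<in> U"
        using open_contains_cylinder U by blast
      then have "(n, word n x) \<in> ?I" by (auto simp: word_def)
      then show "x \<in> (\<Union>(n, w)\<in>?I. {x. word n x = w})" by blast
    qed auto
    finally show ?thesis .
  qed
  then have "{U. open U} \<subseteq> sets ?S" by blast
  then have "sigma_sets (space ?S) {U. open U} \<subseteq> sets ?S" by (rule sets.sigma_sets_subset)
  moreover have "sets (borel :: (nat \<Rightarrow> bool) measure) = sigma_sets UNIV {U. open U}"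
    by (simp add: borel_def)
  ultimately show "sets (borel :: (nat \<Rightarrow> bool) measure) \<subseteq> sigma_sets UNIV ?G"
    by (simp only: S space_measure_of_conv)
  show "sigma_sets UNIV ?G \<subseteq> sets (borel :: (nat \<Rightarrow> bool) measure)"
  proof -
    have "?G \<subseteq> sets (borel :: (nat \<Rightarrow> bool) measure)" by (auto intro!: borel_open open_pattern)
    then show ?thesis
      using sets.sigma_sets_subset[of ?G "borel :: (nat \<Rightarrow> bool) measure"] by simp
  qed
qed

locale shift_invariant_measure =
  fixes X :: "(nat \<Rightarrow> bool) set" and M
  assumes inv: "invariant_borel_prob X left_shift M"
begin

sublocale prob_space M using inv by (simp add: invariant_borel_prob_def)

lemma preserving: "left_shift \<in> measurable M M" "distr M M left_shift = M"
  using inv by (auto simp: invariant_borel_prob_def)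

lemma sets_eq: "sets M = sigma_sets X {X \<inter> {x. \<forall>j\<in>F. x j} | F. finite F}"
proof -
  have "sets M = (\<inter>) X ` sigma_sets UNIV {{x. \<forall>j\<in>F. x j} | F. finite F}"
    using inv by (simp add: invariant_borel_prob_def sets_restrict_space sets_borel_patterns)
  also have "\<dots> = sigma_sets X ((\<inter>) X ` {{x. \<forall>j\<in>F. x j} | F. finite F})"
  proof -
    have "(\<inter>) X ` \<S> = {(\<lambda>x. x) -` A \<inter> X | A. A \<in> \<S>}" for \<S> by auto
    then show ?thesis by (simp only: sigma_sets_vimage_commute Pi_UNIV UNIV_I Pi_I)
  qed
  also have "(\<inter>) X ` {{x. \<forall>j\<in>F. x j} | F. finite F} = {X \<inter> {x. \<forall>j\<in>F. x j} | F. finite F}"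
    by blast
  finally show ?thesis .
qed

lemma space_eq: "space M = X"
proof -
  have "sets M = sets (restrict_space borel X)" using inv by (simp add: invariant_borel_prob_def)
  then have "space M = space (restrict_space borel X)" by (rule sets_eq_imp_space_eq)
  then show ?thesis by (simp add: space_restrict_space)
qed

lemma pattern_sets: "finite F \<Longrightarrow> {x \<in> space M. \<forall>j\<in>F. x j} \<in> sets M"
  unfolding sets_eq space_eq by (intro sigma_sets.Basic) blast

lemma coordinate_measurable [measurable]: "Measurable.pred M (\<lambda>x. x j)"
  using pattern_sets[of "{j}"] by (simp add: pred_def)

lemma simple_word: "simple_function M (word n)"
  unfolding simple_function_def
proof (intro conjI ballI finite_words)
  fix w assume "w \<in> word n ` space M"
  then have "w \<subseteq> {..<n}" by (auto simp: word_def)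
  then have "word n x = w \<longleftrightarrow> (\<forall>i\<in>{..<n}. x i = (i \<in> w))" for x
    unfolding word_def by blast
  then have "word n -` {w} \<inter> space M = {x \<in> space M. \<forall>i\<in>{..<n}. x i = (i \<in> w)}"
    by blast
  also have "\<dots> \<in> sets M" by measurable
  finally show "word n -` {w} \<inter> space M \<in> sets M" .
qed

lemma stationary:
  assumes "finite F"
  shows "prob {x \<in> space M. \<forall>j\<in>F. x (i + j)} = prob {x \<in> space M. \<forall>j\<in>F. x j}"
proof -
  note T = measure_preserving_funpow[OF preserving, of i]
  have "prob {x \<in> space M. \<forall>j\<in>F. x j} = measure (distr M M (left_shift ^^ i)) {x \<in> space M. \<forall>j\<in>F. x j}"
    by (simp add: T(2))
  also have "\<dots> = prob ((left_shift ^^ i) -` {x \<in> space M. \<forall>j\<in>F. x j} \<inter> space M)"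
    by (intro measure_distr T pattern_sets assms)
  also have "(left_shift ^^ i) -` {x \<in> space M. \<forall>j\<in>F. x j} \<inter> space M = {x \<in> space M. \<forall>j\<in>F. x (i + j)}"
    using measurable_space[OF T(1)] by (auto simp: funpow_left_shift)
  finally show ?thesis ..
qed

lemma entropy_word_add: "entropy_of M (word (m + n)) \<le> entropy_of M (word m) + entropy_of M (word n)"
proof -
  note Tm = simple_function_measurable_comp[OF simple_word measure_preserving_funpow(1)[OF preserving]]
  have "entropy_of M (word (m + n)) \<le> entropy_of M (\<lambda>x. (word m x, word n ((left_shift ^^ m) x)))"
  proof (rule entropy_of_function_le[where h="\<lambda>(a, b). a \<union> (+) m ` b"])
    fix x :: "nat \<Rightarrow> bool"
    have "i \<in> (+) m ` word n ((left_shift ^^ m) x)" if "i \<in> word (m + n) x" "i \<notin> word m x" for i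
      using that by (intro image_eqI[of _ _ "i - m"]) (auto simp: word_def funpow_left_shift)
    then show "word (m + n) x = (case (word m x, word n ((left_shift ^^ m) x)) of (a, b) \<Rightarrow> a \<union> (+) m ` b)"
      by (auto simp: word_def funpow_left_shift)
  qed (intro simple_function_Pair simple_word Tm)+
  also have "\<dots> \<le> entropy_of M (word m) + entropy_of M (\<lambda>x. word n ((left_shift ^^ m) x))"
    by (intro entropy_of_pair_subadditive simple_word Tm)
  finally show ?thesis by (simp add: entropy_of_shifted[OF preserving simple_word])
qed

definition word_entropy :: real where
  "word_entropy = lim (\<lambda>n. entropy_of M (word n) / n)"

lemma word_entropy_tendsto: "(\<lambda>n. entropy_of M (word n) / n) \<longlonglongrightarrow> word_entropy"
  unfolding word_entropy_def by (intro fekete(1) entropy_word_add entropy_of_nonneg)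

lemma word_entropy_le: "n * word_entropy \<le> entropy_of M (word n)"
proof (cases "n > 0")
  case True
  have "word_entropy \<le> entropy_of M (word n) / n"
    unfolding word_entropy_def by (intro fekete(2) entropy_word_add entropy_of_nonneg True)
  with True show ?thesis by (simp add: field_simps)
qed (simp add: entropy_of_nonneg)

end

section \<open>Generation by words, and uniqueness\<close>

lemma exp_le_quadratic:
  fixes t :: real
  assumes "\<bar>t\<bar> \<le> 1"
  shows "exp t \<le> 1 + t + t\<^sup>2"
proof (cases "t \<ge> 0")
  case True
  with assms show ?thesis by (intro exp_bound) auto
next
  case False
  define s where "s = - t"
  have s: "0 < s" "s \<le> 1" using False assms by (auto simp: s_def)
  have "1 \<le> (1 + s) * (1 - s + s\<^sup>2)"
    using s by (simp add: algebra_simps power2_eq_square)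
  also have "\<dots> \<le> exp s * (1 - s + s\<^sup>2)"
    using s by (intro mult_right_mono exp_ge_add_one_self) auto
  finally have "exp (- s) \<le> 1 - s + s\<^sup>2" by (simp add: exp_minus field_simps)
  then show ?thesis by (simp add: s_def)
qed

context shift_invariant_measure
begin

lemma word_event_sets: "{x \<in> space M. word n x \<in> W} \<in> sets M"
proof -
  have "{x \<in> space M. word n x \<in> W} = word n -` W \<inter> space M" by auto
  then show ?thesis using simple_functionD(2)[OF simple_word, of n W] by simp
qed

text \<open>
  The sets with this approximation property form a \<open>\<sigma>\<close>-algebra that contains the generators. For a
  countable union, finitely many of the sets carry all but \<open>\<epsilon> / 2\<close> of the mass, and these are approximated
  by events of a common word length.
\<close>

lemma approx_by_word_event:
  assumes "A \<in> sets M" "\<epsilon> > 0"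
  shows "\<exists>n W. prob (sym_diff A {x \<in> space M. word n x \<in> W}) < \<epsilon>"
proof -
  have "A \<in> sigma_sets X {X \<inter> {x. \<forall>j\<in>F. x j} | F. finite F}" using assms(1) sets_eq by simp
  then show ?thesis using assms(2)
  proof (induction arbitrary: \<epsilon> rule: sigma_sets.induct)
    case (Basic A)
    then obtain F where F: "finite F" "A = X \<inter> {x. \<forall>j\<in>F. x j}" by blast
    obtain n where n: "F \<subseteq> {..<n}" using finite_nat_iff_bounded F(1) by blast
    have "{x \<in> space M. word n x \<in> {w. F \<subseteq> w}} = A"
      using n by (auto simp: F(2) space_eq word_def)
    then have "prob (sym_diff A {x \<in> space M. word n x \<in> {w. F \<subseteq> w}}) < \<epsilon>"
      using Basic(2) by (simp only: Diff_cancel Un_empty_left measure_empty)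
    then show ?case by (intro exI)
  next
    case Empty
    have "prob (sym_diff {} {x \<in> space M. word 0 x \<in> {}}) < \<epsilon>" using Empty by simp
    then show ?case by (intro exI)
  next
    case (Compl A)
    then obtain n W where W: "prob (sym_diff A {x \<in> space M. word n x \<in> W}) < \<epsilon>" by blast
    have "A \<subseteq> X" using Compl(1) by (rule sigma_sets_into_sp[rotated]) blast
    then have eq: "sym_diff (X - A) {x \<in> space M. word n x \<in> - W} = sym_diff A {x \<in> space M. word n x \<in> W}"
      unfolding space_eq by blast
    have "prob (sym_diff (X - A) {x \<in> space M. word n x \<in> - W}) < \<epsilon>"
      unfolding eq by (rule W)
    then show ?case by (intro exI)
  next
    case (Union a)
    have a: "a i \<in> sets M" for i using Union(1) sets_eq by simp
    have "(\<lambda>N. prob (\<Union>i<N. a i)) \<longlonglongrightarrow> prob (\<Union>N. \<Union>i<N. a i)"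
    proof (rule finite_Lim_measure_incseq)
      show "incseq (\<lambda>N. \<Union>i<N. a i)" by (intro monoI UN_mono) auto
    qed (use a in \<open>auto intro!: sets.finite_UN\<close>)
    moreover have "(\<Union>N. \<Union>i<N. a i) = (\<Union>i. a i)" by auto
    ultimately have "(\<lambda>N. prob (\<Union>i<N. a i)) \<longlonglongrightarrow> prob (\<Union>i. a i)" by simp
    from LIMSEQ_D[OF this, of "\<epsilon> / 2"] Union(3)
    obtain N where N': "\<forall>n\<ge>N. norm (prob (\<Union>i<n. a i) - prob (\<Union>i. a i)) < \<epsilon> / 2" by auto
    then have N: "prob (\<Union>i. a i) - prob (\<Union>i<N. a i) < \<epsilon> / 2"
      using N'[rule_format, of N] unfolding real_norm_def by linarith
    define e where "e = \<epsilon> / (2 * (real N + 1))"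
    have e: "e > 0" using Union(3) by (simp add: e_def)
    have "\<exists>c. prob (sym_diff (a i) {x \<in> space M. word (fst c) x \<in> snd c}) < e" for i
      using Union(2)[OF e, of i] by (elim exE) (rule exI[of _ "(_, _)"], simp only: fst_conv snd_conv)
    then have "\<forall>i. \<exists>c. prob (sym_diff (a i) {x \<in> space M. word (fst c) x \<in> snd c}) < e" ..
    from choice[OF this] obtain c where
      c: "\<forall>i. prob (sym_diff (a i) {x \<in> space M. word (fst (c i)) x \<in> snd (c i)}) < e" ..
    define n where "n i = fst (c i)" for i
    define W where "W i = snd (c i)" for i
    have W: "prob (sym_diff (a i) {x \<in> space M. word (n i) x \<in> W i}) < e" for i
      using c unfolding n_def W_def by (rule spec)
    define m where "m = (\<Sum>i<N. n i)"
    have nm: "n i \<le> m" if "i < N" for i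
      unfolding m_def using that by (intro member_le_sum) auto
    define V where "V = {w. \<exists>i<N. w \<inter> {..<n i} \<in> W i}"
    let ?S = "\<lambda>i. sym_diff (a i) {x \<in> space M. word (n i) x \<in> W i}"
    have S: "?S i \<in> sets M" for i by (intro sets.Un sets.Diff a word_event_sets)
    have sets: "(\<Union>i. a i) \<in> sets M" "(\<Union>i<N. a i) \<in> sets M" "(\<Union>i<N. ?S i) \<in> sets M"
      by (auto intro!: sets.countable_UN sets.finite_UN a S simp del: Un_iff)
    have "prob (sym_diff (\<Union>i. a i) {x \<in> space M. word m x \<in> V})
        \<le> prob (((\<Union>i. a i) - (\<Union>i<N. a i)) \<union> (\<Union>i<N. ?S i))"
    proof (intro finite_measure_mono subsetI)
      fix x assume x: "x \<in> sym_diff (\<Union>i. a i) {x \<in> space M. word m x \<in> V}"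
      have V: "word m x \<in> V \<longleftrightarrow> (\<exists>i<N. word (n i) x \<in> W i)"
        unfolding V_def using word_prefix[OF nm] by auto
      have "x \<in> space M" using x sets.sets_into_space[OF a] by blast
      with x V show "x \<in> ((\<Union>i. a i) - (\<Union>i<N. a i)) \<union> (\<Union>i<N. ?S i)" by blast
    qed (intro sets.Un sets.Diff sets)
    also have "\<dots> \<le> prob ((\<Union>i. a i) - (\<Union>i<N. a i)) + prob (\<Union>i<N. ?S i)"
      by (intro measure_Un_le sets.Diff sets)
    also have "prob ((\<Union>i. a i) - (\<Union>i<N. a i)) = prob (\<Union>i. a i) - prob (\<Union>i<N. a i)"
      by (intro finite_measure_Diff sets) auto
    also have "prob (\<Union>i<N. ?S i) \<le> (\<Sum>i<N. prob (?S i))"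
      by (intro finite_measure_subadditive_finite) (auto simp: S simp del: Un_iff)
    also have "\<dots> \<le> (\<Sum>i<N. e)" using W by (intro sum_mono) (simp add: less_imp_le)
    also have "\<dots> \<le> \<epsilon> / 2" using Union(3) by (simp add: e_def field_simps)
    finally have "prob (sym_diff (\<Union>i. a i) {x \<in> space M. word m x \<in> V}) < \<epsilon>" using N by linarith
    then show ?case by (intro exI)
  qed
qed

lemma approx_part_of_by_words:
  assumes P: "finite_measurable_partition M P" and \<epsilon>: "\<epsilon> > 0"
  shows "\<exists>n L. prob {x \<in> space M. part_of P x \<noteq> L (word n x)} < \<epsilon>"
proof -
  have P': "finite P" "P \<subseteq> sets M" "partition_on (space M) P"
    using P by (auto simp: finite_measurable_partition_def)
  define e where "e = \<epsilon> / (real (card P) + 1)"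
  have e: "e > 0" using \<epsilon> by (simp add: e_def)
  have "\<forall>A\<in>P. \<exists>c. prob (sym_diff A {x \<in> space M. word (fst c) x \<in> snd c}) < e"
  proof
    fix A assume "A \<in> P"
    then have "A \<in> sets M" using P'(2) by blast
    from approx_by_word_event[OF this e]
    obtain n W where "prob (sym_diff A {x \<in> space M. word n x \<in> W}) < e" by (elim exE)
    then show "\<exists>c. prob (sym_diff A {x \<in> space M. word (fst c) x \<in> snd c}) < e"
      by (intro exI[of _ "(n, W)"]) (simp only: fst_conv snd_conv)
  qed
  from bchoice[OF this] obtain c where
    c: "\<forall>A\<in>P. prob (sym_diff A {x \<in> space M. word (fst (c A)) x \<in> snd (c A)}) < e" ..
  define n where "n A = fst (c A)" for A
  define W where "W A = snd (c A)" for A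
  have W: "prob (sym_diff A {x \<in> space M. word (n A) x \<in> W A}) < e" if "A \<in> P" for A
    unfolding n_def W_def using c that by (rule bspec)
  define m where "m = (\<Sum>A\<in>P. n A)"
  have nm: "n A \<le> m" if "A \<in> P" for A
    unfolding m_def using that P'(1) by (intro member_le_sum) auto
  define L where "L w = (SOME A. A \<in> P \<and> w \<inter> {..<n A} \<in> W A)" for w
  let ?S = "\<lambda>A. sym_diff A {x \<in> space M. word (n A) x \<in> W A}"
  have S: "?S A \<in> sets M" if "A \<in> P" for A
    using that P'(2) by (intro sets.Un sets.Diff word_event_sets) auto
  have "prob {x \<in> space M. part_of P x \<noteq> L (word m x)} \<le> prob (\<Union>A\<in>P. ?S A)"
  proof (intro finite_measure_mono subsetI)
    fix x assume x: "x \<in> {x \<in> space M. part_of P x \<noteq> L (word m x)}"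
    then have px: "part_of P x \<in> P" using part_of(1)[OF P'(3)] by blast
    show "x \<in> (\<Union>A\<in>P. ?S A)"
    proof (rule ccontr)
      assume "x \<notin> (\<Union>A\<in>P. ?S A)"
      then have eq: "x \<in> A \<longleftrightarrow> word (n A) x \<in> W A" if "A \<in> P" for A using x that by blast
      have mem: "A \<in> P \<and> word m x \<inter> {..<n A} \<in> W A \<longleftrightarrow> A = part_of P x" for A
      proof (cases "A \<in> P")
        case True
        have "part_of P x = A \<longleftrightarrow> x \<in> A" using part_of(2)[OF P'(3) _ True] x by blast
        then show ?thesis using eq[OF True] True by (auto simp: word_prefix[OF nm])
      qed (use px in auto)
      have "L (word m x) = part_of P x" unfolding L_def mem by simp
      with x show False by simp
    qed
  qed (intro sets.finite_UN S P'(1))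
  also have "\<dots> \<le> (\<Sum>A\<in>P. prob (?S A))"
    using S P'(1) by (intro finite_measure_subadditive_finite image_subsetI)
  also have "\<dots> \<le> (\<Sum>A\<in>P. e)" using W by (intro sum_mono) (simp add: less_imp_le)
  also have "\<dots> < \<epsilon>" using \<epsilon> by (simp add: e_def field_simps)
  finally show ?thesis by blast
qed

text \<open>
  A long word determines, for each \<open>i < n\<close>, the guess \<open>L\<close> for the label at time \<open>i\<close>, made from the window of
  length \<open>m\<close> that starts at \<open>i\<close>. The labels are appended one at a time, each at the mean cost of correcting
  its guess; by invariance this cost is the same at all times.
\<close>

lemma entropy_names_le_word:
  fixes k :: "'c \<Rightarrow> 'c \<Rightarrow> real"
  assumes l: "simple_function M l"
    and k: "\<And>b. (\<Sum>a\<in>atoms M l. exp (- k a b)) \<le> 1"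
  shows "n \<le> n' \<Longrightarrow> entropy_of M (\<lambda>x. (names left_shift l n x, word (n' + m) x))
    \<le> entropy_of M (word (n' + m)) + n * (\<integral>x. k (l x) (L (word m x)) \<partial>M)"
proof (induction n)
  case 0
  have "entropy_of M (\<lambda>x. (names left_shift l 0 x, word (n' + m) x)) \<le> entropy_of M (word (n' + m))"
    by (rule entropy_of_function_le[where h="\<lambda>w. ([], w)"])
      (auto intro!: simple_word simple_function_Pair simple_function_names preserving l simp: names_def)
  then show ?case by simp
next
  case (Suc n)
  note T = measure_preserving_funpow[OF preserving, of n]
  let ?f = "\<lambda>x. (names left_shift l n x, word (n' + m) x)"
  let ?u = "\<lambda>x. l ((left_shift ^^ n) x)"
  let ?b = "\<lambda>(a::'c list, w). L {i. i < m \<and> n + i \<in> w}"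
  have f: "simple_function M ?f"
    by (intro simple_function_Pair simple_word simple_function_names preserving l)
  have u: "simple_function M ?u" by (rule simple_function_measurable_comp[OF l T(1)])
  have "fibre_prob M ?u = fibre_prob M l"
  proof
    fix y
    have "fibre_prob M l y = measure (distr M M (left_shift ^^ n)) {x \<in> space M. l x = y}"
      by (simp add: T(2) fibre_prob_def)
    also have "\<dots> = prob ((left_shift ^^ n) -` {x \<in> space M. l x = y} \<inter> space M)"
      by (intro measure_distr T simple_function_fibre l)
    also have "(left_shift ^^ n) -` {x \<in> space M. l x = y} \<inter> space M = {x \<in> space M. ?u x = y}"
      using measurable_space[OF T(1)] by blast
    finally show "fibre_prob M ?u y = fibre_prob M l y" by (simp add: fibre_prob_def)
  qed
  then have "atoms M ?u \<subseteq> atoms M l"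
    unfolding atoms_def using measurable_space[OF T(1)] by auto
  then have k': "(\<Sum>a\<in>atoms M ?u. exp (- k a b)) \<le> 1" for b
    using sum_mono2[OF finite_atoms[OF l], of "atoms M ?u" "\<lambda>a. exp (- k a b)"] k[of b] by simp
  have b: "?b (?f x) = L (word m ((left_shift ^^ n) x))" for x
  proof -
    have "{i. i < m \<and> n + i \<in> word (n' + m) x} = word m ((left_shift ^^ n) x)"
      using Suc.prems by (auto simp: word_def funpow_left_shift)
    then show ?thesis by simp
  qed
  have int: "(\<integral>x. k (?u x) (?b (?f x)) \<partial>M) = (\<integral>x. k (l x) (L (word m x)) \<partial>M)"
  proof -
    let ?g = "\<lambda>x. k (l x) (L (word m x))"
    have "simple_function M (\<lambda>x. (\<lambda>(a, w). k a (L w)) (l x, word m x))"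
      by (intro simple_function_compose1[of M _ "\<lambda>(a, w). k a (L w)"] simple_function_Pair l simple_word)
    then have "?g \<in> borel_measurable M" by (simp add: borel_measurable_simple_function)
    then have "(\<integral>x. ?g x \<partial>distr M M (left_shift ^^ n)) = (\<integral>x. ?g ((left_shift ^^ n) x) \<partial>M)"
      by (rule integral_distr[OF T(1)])
    then show ?thesis unfolding b by (simp add: T(2))
  qed
  have "entropy_of M (\<lambda>x. (names left_shift l (Suc n) x, word (n' + m) x)) \<le> entropy_of M (\<lambda>x. (?f x, ?u x))"
    by (rule entropy_of_function_le[where h="\<lambda>((a, w), c). (a @ [c], w)", OF simple_function_Pair[OF f u]
          simple_function_Pair[OF simple_function_names[OF preserving(1) l] simple_word]])
      (simp add: names_Suc)
  also have "\<dots> \<le> entropy_of M ?f + (\<integral>x. k (?u x) (?b (?f x)) \<partial>M)"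
    by (rule entropy_of_pair_le[OF f u k'])
  also have "\<dots> \<le> entropy_of M (word (n' + m)) + Suc n * (\<integral>x. k (l x) (L (word m x)) \<partial>M)"
    unfolding int using Suc by (simp add: algebra_simps)
  finally show ?case .
qed

text \<open>
  This is the Kolmogorov--Sinai theorem for the partition according to the first coordinate. The cell of
  a point is guessed from a word of length \<open>m\<close>. A correct guess is confirmed with a code word of length
  \<open>- ln (1 - \<delta>) = \<epsilon> / 2\<close>; an error costs \<open>B = ln (c / \<delta>)\<close>, and \<open>m\<close> is chosen such that errors are rare
  enough to add at most \<open>\<epsilon> / 2\<close> on average.
\<close>

lemma measure_entropy_partition_le:
  assumes P: "finite_measurable_partition M P"
  shows "measure_entropy_partition M left_shift P \<le> word_entropy"
proof (rule field_le_epsilon)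
  fix \<epsilon> :: real assume \<epsilon>: "\<epsilon> > 0"
  let ?l = "part_of P"
  have l: "simple_function M ?l" by (rule simple_function_part_of[OF P])
  define \<delta> where "\<delta> = 1 - exp (- \<epsilon> / 2)"
  have \<delta>: "0 < \<delta>" "\<delta> < 1" using \<epsilon> by (auto simp: \<delta>_def)
  have c0: "atoms M ?l \<noteq> {}" using sum_fibre_prob[OF l] by auto
  define c where "c = real (card (atoms M ?l))"
  have c: "c \<ge> 1" using c0 finite_atoms[OF l] by (simp add: c_def Suc_le_eq card_gt_0_iff)
  define B where "B = - ln (\<delta> / c)"
  have B: "B > 0" using \<delta> c by (simp add: B_def)
  define k where "k a b = (if a = b then - ln (1 - \<delta>) else B)" for a b :: "(nat \<Rightarrow> bool) set"
  have k: "(\<Sum>a\<in>atoms M ?l. exp (- k a b)) \<le> 1" for b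
  proof -
    have "(\<Sum>a\<in>atoms M ?l. exp (- k a b)) \<le> (\<Sum>a\<in>atoms M ?l. (if a = b then 1 - \<delta> else 0) + \<delta> / c)"
      using \<delta> c by (intro sum_mono) (auto simp: k_def B_def)
    also have "\<dots> \<le> (1 - \<delta>) + c * (\<delta> / c)"
      using \<delta> finite_atoms[OF l] by (simp add: sum.distrib c_def sum.delta)
    also have "\<dots> = 1" using c by simp
    finally show ?thesis .
  qed
  obtain m L where L: "prob {x \<in> space M. ?l x \<noteq> L (word m x)} < \<epsilon> / 2 / B"
    using approx_part_of_by_words[OF P, of "\<epsilon> / 2 / B"] \<epsilon> B by auto
  define \<eta> where "\<eta> = (\<integral>x. k (?l x) (L (word m x)) \<partial>M)"
  have lw: "simple_function M (\<lambda>x. (?l x, word m x))" by (intro simple_function_Pair l simple_word)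
  have eq: "{x \<in> space M. ?l x \<noteq> L (word m x)} = (\<lambda>x. (?l x, word m x)) -` {(a, w). a \<noteq> L w} \<inter> space M"
    by auto
  have S: "{x \<in> space M. ?l x \<noteq> L (word m x)} \<in> sets M"
    unfolding eq by (rule simple_functionD(2)[OF lw])
  have int: "integrable M (indicator {x \<in> space M. ?l x \<noteq> L (word m x)} :: _ \<Rightarrow> real)"
    by (intro integrable_real_indicator S) (simp add: less_top[symmetric])
  have "\<eta> \<le> (\<integral>x. \<epsilon> / 2 + B * indicator {x \<in> space M. ?l x \<noteq> L (word m x)} x \<partial>M)"
    unfolding \<eta>_def
  proof (rule integral_mono)
    show "integrable M (\<lambda>x. k (?l x) (L (word m x)))"
      using expectation_simple(1)[OF lw, of "\<lambda>(a, w). k a (L w)"] by simp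
    show "integrable M (\<lambda>x. \<epsilon> / 2 + B * indicator {x \<in> space M. ?l x \<noteq> L (word m x)} x)"
      by (intro Bochner_Integration.integrable_add integrable_mult_right int) simp
    fix x assume x: "x \<in> space M"
    show "k (?l x) (L (word m x)) \<le> \<epsilon> / 2 + B * indicator {x \<in> space M. ?l x \<noteq> L (word m x)} x"
      using x \<epsilon> by (auto simp: k_def \<delta>_def)
  qed
  also have "\<dots> = \<epsilon> / 2 + B * prob {x \<in> space M. ?l x \<noteq> L (word m x)}"
  proof -
    show ?thesis
      using int by (subst Bochner_Integration.integral_add) (auto simp: prob_space Int_absorb2)
  qed
  also have "\<dots> \<le> \<epsilon>" using L B by (simp add: field_simps)
  finally have \<eta>: "\<eta> \<le> \<epsilon>" .
  have bound: "entropy_of M (names left_shift ?l n) / n \<le> entropy_of M (word n) / n + entropy_of M (word m) / n + \<epsilon>"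
    if n: "n > 0" for n
  proof -
    have "entropy_of M (names left_shift ?l n) \<le> entropy_of M (\<lambda>x. (names left_shift ?l n x, word (n + m) x))"
      by (rule entropy_of_function_le[where h=fst])
        (auto intro!: simple_function_Pair simple_word simple_function_names preserving l)
    also have "\<dots> \<le> entropy_of M (word (n + m)) + n * \<eta>"
      unfolding \<eta>_def by (rule entropy_names_le_word[OF l k]) simp
    also have "\<dots> \<le> entropy_of M (word n) + entropy_of M (word m) + n * \<epsilon>"
      using entropy_word_add[of n m] \<eta> by (intro add_mono mult_left_mono) auto
    finally show ?thesis using n by (simp add: field_simps)
  qed
  have "(\<lambda>n. entropy_of M (word n) / n + entropy_of M (word m) / n + \<epsilon>) \<longlonglongrightarrow> word_entropy + 0 + \<epsilon>"
    by (intro tendsto_add word_entropy_tendsto lim_const_over_n tendsto_const)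
  then have "measure_entropy_partition M left_shift P \<le> word_entropy + 0 + \<epsilon>"
    using measure_entropy_partition_names[OF preserving P] bound
    by (intro LIMSEQ_le[of _ _ _ "word_entropy + 0 + \<epsilon>"]) (auto intro!: exI[of _ 1])
  then show "measure_entropy_partition M left_shift P \<le> word_entropy + \<epsilon>" by simp
qed

theorem measure_entropy_le: "measure_entropy M left_shift \<le> ereal word_entropy"
  unfolding measure_entropy_def
  by (intro SUP_least) (auto intro: measure_entropy_partition_le)

text \<open>
  Itineraries for the partition according to the first coordinate determine words.
\<close>

lemma measure_entropy_ge:
  assumes "{x \<in> X. x 0} \<noteq> {}" "{x \<in> X. \<not> x 0} \<noteq> {}"
  shows "ereal word_entropy \<le> measure_entropy M left_shift"
proof -
  let ?P = "{{x \<in> X. x 0}, {x \<in> X. \<not> x 0}}"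
  have "{x \<in> space M. x 0} \<in> sets M" "{x \<in> space M. \<not> x 0} \<in> sets M" by measurable
  then have sets: "?P \<subseteq> sets M" by (simp add: space_eq)
  have part: "partition_on X ?P"
    unfolding partition_on_def disjoint_def using assms by blast
  have P: "finite_measurable_partition M ?P"
    using sets part by (simp add: finite_measurable_partition_def space_eq)
  have part_of_0: "part_of ?P x = {x \<in> X. x 0} \<longleftrightarrow> x 0" if "x \<in> X" for x
    using part_of(2)[OF part that, of "{x \<in> X. x 0}"] that by simp
  have "entropy_of M (word n) \<le> entropy_of M (names left_shift (part_of ?P) n)" for n
  proof (rule entropy_of_function_le[where h="\<lambda>a. {i. i < n \<and> a ! i = {x \<in> X. x 0}}"])
    fix x assume x: "x \<in> space M"
    have "(left_shift ^^ i) x \<in> X" for i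
      using measurable_space[OF measure_preserving_funpow(1)[OF preserving] x] by (simp add: space_eq)
    then have "names left_shift (part_of ?P) n x ! i = {x \<in> X. x 0} \<longleftrightarrow> x i" if "i < n" for i
      using that part_of_0[of "(left_shift ^^ i) x"] by (simp add: names_def funpow_left_shift)
    then show "word n x = {i. i < n \<and> names left_shift (part_of ?P) n x ! i = {x \<in> X. x 0}}"
      unfolding word_def by blast
  qed (intro simple_word simple_function_names preserving simple_function_part_of P)+
  then have "word_entropy \<le> measure_entropy_partition M left_shift ?P"
    by (intro LIMSEQ_le[OF word_entropy_tendsto measure_entropy_partition_names[OF preserving P]])
      (auto intro!: divide_right_mono)
  also have "ereal (measure_entropy_partition M left_shift ?P) \<le> measure_entropy M left_shift"
    unfolding measure_entropy_def using P by (intro SUP_upper) auto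
  finally show ?thesis by simp
qed

text \<open>
  With \<open>t = s\<close> and \<open>t = - s\<close> in \<open>entropy_forces_pattern\<close>, and \<open>e\<^sup>t - 1 = t + O(t\<^sup>2)\<close>, the difference between
  probability and density is at most of order \<open>s\<close> once \<open>K\<close> is so large that the entropy deficit is below \<open>s\<^sup>2\<close>.
\<close>

lemma pattern_prob_limit:
  assumes X: "X = squarefree_flow" and F: "finite F"
    and lim: "(\<lambda>K. pattern_density K {0} * ln 2) \<longlonglongrightarrow> h" and h: "h \<le> word_entropy"
  shows "(\<lambda>K. pattern_density K F / 2 ^ card F) \<longlonglongrightarrow> prob {x \<in> space M. \<forall>j\<in>F. x j}"
proof (rule LIMSEQ_I)
  fix r :: real assume r: "r > 0"
  let ?P = "prob {x \<in> space M. \<forall>j\<in>F. x j}"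
  let ?m = "\<lambda>K. pattern_density K F / 2 ^ card F"
  obtain L0 where "F \<subseteq> {..<L0}" using finite_nat_iff_bounded F by blast
  then have L: "F \<subseteq> {..<Suc L0}" by auto
  define L where "L = Suc L0"
  have key: "t * ?P \<le> L * (pattern_density K {0} * ln 2 - h) + (exp t - 1) * ?m K" for t K
  proof (rule entropy_forces_pattern[of "\<lambda>x. x"])
    show "real n * h \<le> entropy_of M (word n)" for n
      using word_entropy_le[of n] mult_left_mono[OF h, of "real n"] by linarith
    show "prob {x \<in> space M. \<forall>j\<in>F. x (i + j)} = prob {x \<in> space M. \<forall>j\<in>F. x j}" for i
      by (rule stationary[OF F])
  qed (use L X in \<open>simp_all add: L_def space_eq simple_word\<close>)
  have m: "0 \<le> ?m K" "?m K \<le> 1" for K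
    using pattern_density_bounds[of K F] by (auto simp: divide_le_eq_1 intro: order_trans[of _ 1])
  (* the final error is 2 * s, which has to be less than r *)
  define s where "s = min 1 (r / 3)"
  have s: "0 < s" "s \<le> 1" "2 * s < r" using r by (auto simp: s_def)
  have "(\<lambda>K. L * (pattern_density K {0} * ln 2 - h)) \<longlonglongrightarrow> L * (h - h)"
    by (intro tendsto_intros lim)
  then obtain N where N: "\<And>K. K \<ge> N \<Longrightarrow> \<bar>L * (pattern_density K {0} * ln 2 - h)\<bar> < s\<^sup>2"
    using LIMSEQ_D[of _ 0 "s\<^sup>2"] s by fastforce
  have bound: "t * (?P - ?m K) \<le> 2 * s\<^sup>2" if K: "K \<ge> N" and t: "\<bar>t\<bar> = s" for K t
  proof -
    have "(exp t - 1 - t) * ?m K \<le> s\<^sup>2 * 1"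
    proof (intro mult_mono m)
      have "t\<^sup>2 = s\<^sup>2" using t by (metis power2_abs)
      then show "exp t - 1 - t \<le> s\<^sup>2" using exp_le_quadratic[of t] t s by simp
    qed auto
    moreover have "(exp t - 1) * ?m K = (exp t - 1 - t) * ?m K + t * ?m K"
      by (simp only: left_diff_distrib)
    moreover have "t * (?P - ?m K) = t * ?P - t * ?m K" by (rule right_diff_distrib)
    ultimately show ?thesis using key[of t K] N[OF K] by linarith
  qed
  show "\<exists>N. \<forall>K\<ge>N. norm (?m K - ?P) < r"
  proof (intro exI allI impI)
    fix K assume K: "K \<ge> N"
    have "s * (?P - ?m K) \<le> s * (2 * s)" "s * (?m K - ?P) \<le> s * (2 * s)"
      using bound[OF K, of s] bound[OF K, of "- s"] s by (auto simp: power2_eq_square algebra_simps)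
    then have "?P - ?m K \<le> 2 * s" "?m K - ?P \<le> 2 * s" using s by simp_all
    then show "norm (?m K - ?P) < r" using s by simp
  qed
qed

end

text \<open>
  The events on which all of a finite set of positions carries ones form a generating family closed under
  intersection, and \<open>pattern_prob_limit\<close> expresses their probabilities by the sieve alone.
\<close>

theorem max_entropy_unique:
  assumes M: "shift_invariant_measure squarefree_flow M" "h \<le> shift_invariant_measure.word_entropy M"
    and N: "shift_invariant_measure squarefree_flow N" "h \<le> shift_invariant_measure.word_entropy N"
    and lim: "(\<lambda>K. pattern_density K {0} * ln 2) \<longlonglongrightarrow> h"
  shows "M = N"
proof -
  interpret M: shift_invariant_measure squarefree_flow M by (rule M)
  interpret N: shift_invariant_measure squarefree_flow N by (rule N)
  let ?E = "{squarefree_flow \<inter> {x. \<forall>j\<in>F. x j} | F. finite F}"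
  show ?thesis
  proof (rule measure_eqI_generator_eq[of ?E squarefree_flow M N "\<lambda>_. squarefree_flow"])
    show "Int_stable ?E"
    proof (rule Int_stableI)
      fix a b assume "a \<in> ?E" "b \<in> ?E"
      then obtain F G where "finite F" "a = squarefree_flow \<inter> {x. \<forall>j\<in>F. x j}"
        "finite G" "b = squarefree_flow \<inter> {x. \<forall>j\<in>G. x j}" by blast
      then have "a \<inter> b = squarefree_flow \<inter> {x. \<forall>j\<in>F \<union> G. x j}" "finite (F \<union> G)" by auto
      then show "a \<inter> b \<in> ?E" by blast
    qed
    show "emeasure M A = emeasure N A" if "A \<in> ?E" for A
    proof -
      obtain F where F: "finite F" "A = squarefree_flow \<inter> {x. \<forall>j\<in>F. x j}" using \<open>A \<in> ?E\<close> by blast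
      have A: "A = {x \<in> space M. \<forall>j\<in>F. x j}" "A = {x \<in> space N. \<forall>j\<in>F. x j}"
        by (auto simp: F M.space_eq N.space_eq)
      have "measure M A = measure N A"
        using LIMSEQ_unique[OF M.pattern_prob_limit[OF refl F(1) lim M(2)] N.pattern_prob_limit[OF refl F(1) lim N(2)]]
        by (simp add: A[symmetric])
      then show ?thesis by (simp add: M.emeasure_eq_measure N.emeasure_eq_measure)
    qed
    show "range (\<lambda>_. squarefree_flow) \<subseteq> ?E" by (auto intro!: exI[of _ "{}"])
  qed (auto simp: M.sets_eq N.sets_eq)
qed

section \<open>Random residues and fair coins\<close>

text \<open>
  Haar measure on the product of the groups \<open>\<int>/p\<^sup>2\<int>\<close> over all primes \<open>p\<close>.
\<close>

definition residues :: "(nat \<Rightarrow> nat) measure" where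
  "residues = PiM {p. prime p} (\<lambda>p. measure_pmf (pmf_of_set {..<p\<^sup>2}))"

definition coins :: "(nat \<Rightarrow> bool) measure" where
  "coins = PiM UNIV (\<lambda>_. measure_pmf (bernoulli_pmf (1 / 2)))"

definition sample :: "((nat \<Rightarrow> nat) \<times> (nat \<Rightarrow> bool)) measure" where
  "sample = residues \<Otimes>\<^sub>M coins"

definition avoid :: "nat set \<Rightarrow> (nat \<Rightarrow> nat) \<Rightarrow> nat set" where
  "avoid Q \<omega> = {n. \<forall>p\<in>Q. n mod p\<^sup>2 \<noteq> \<omega> p mod p\<^sup>2}"

definition sieved :: "(nat \<Rightarrow> nat) \<times> (nat \<Rightarrow> bool) \<Rightarrow> nat \<Rightarrow> bool" where
  "sieved z n \<longleftrightarrow> n \<in> avoid {p. prime p} (fst z) \<and> snd z n"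

text \<open>
  Subtracts \<open>1\<close> from every residue; \<open>p\<^sup>2 - 1\<close> stands for \<open>- 1\<close> so as to remain in the natural numbers.
\<close>

definition translate :: "(nat \<Rightarrow> nat) \<Rightarrow> nat \<Rightarrow> nat" where
  "translate \<omega> = (\<lambda>p\<in>{p. prime p}. (\<omega> p + (p\<^sup>2 - 1)) mod p\<^sup>2)"

definition sample_shift where
  "sample_shift = (\<lambda>(\<omega>, y). (translate \<omega>, left_shift y))"

interpretation residues: product_prob_space "\<lambda>p. measure_pmf (pmf_of_set {..<p\<^sup>2})" "{p :: nat. prime p}"
  by (intro product_prob_spaceI measure_pmf.prob_space_axioms)

interpretation coins: product_prob_space "\<lambda>_. measure_pmf (bernoulli_pmf (1 / 2))" "UNIV :: nat set"
  by (intro product_prob_spaceI measure_pmf.prob_space_axioms)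

lemma prob_space_residues: "prob_space residues"
  unfolding residues_def by (rule residues.P.prob_space_axioms)

lemma prob_space_coins: "prob_space coins"
  unfolding coins_def by (rule coins.P.prob_space_axioms)

interpretation sample: prob_space sample
  unfolding sample_def by (intro prob_space_pair prob_space_residues prob_space_coins)

lemma distr_PiM_componentwise:
  assumes "\<And>i. prob_space (M i)"
    and f: "\<And>i. i \<in> I \<Longrightarrow> f i \<in> measurable (M i) (M i)"
    and inv: "\<And>i. i \<in> I \<Longrightarrow> distr (M i) (M i) (f i) = M i"
  shows "(\<lambda>\<omega>. \<lambda>i\<in>I. f i (\<omega> i)) \<in> measurable (PiM I M) (PiM I M)"
    and "distr (PiM I M) (PiM I M) (\<lambda>\<omega>. \<lambda>i\<in>I. f i (\<omega> i)) = PiM I M"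
proof -
  interpret product_prob_space M I by (intro product_prob_spaceI assms(1))
  let ?f = "\<lambda>\<omega>. \<lambda>i\<in>I. f i (\<omega> i)"
  show meas: "?f \<in> measurable (PiM I M) (PiM I M)"
  proof (rule measurable_restrict)
    fix i assume "i \<in> I"
    then show "(\<lambda>\<omega>. f i (\<omega> i)) \<in> measurable (PiM I M) (M i)"
      by (intro measurable_compose[of "\<lambda>\<omega>. \<omega> i" _ "M i" "f i"] measurable_component_singleton f)
  qed
  show "distr (PiM I M) (PiM I M) ?f = PiM I M"
  proof (rule PiM_eq)
    fix J F assume J: "finite J" "J \<subseteq> I" and F: "\<And>j. j \<in> J \<Longrightarrow> F j \<in> sets (M j)"
    have pre: "f j -` F j \<inter> space (M j) \<in> sets (M j)" if "j \<in> J" for j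
      using that J F f by (intro measurable_sets) auto
    have "emeasure (distr (PiM I M) (PiM I M) ?f) (prod_emb I M J (Pi\<^sub>E J F))
        = emeasure (PiM I M) (?f -` prod_emb I M J (Pi\<^sub>E J F) \<inter> space (PiM I M))"
      by (intro emeasure_distr meas sets_PiM_I J ballI F)
    also have "?f -` prod_emb I M J (Pi\<^sub>E J F) \<inter> space (PiM I M)
        = {\<omega> \<in> space (PiM I M). \<forall>j\<in>J. \<omega> j \<in> f j -` F j \<inter> space (M j)}"
    proof (intro set_eqI iffI)
      fix \<omega> assume "\<omega> \<in> ?f -` prod_emb I M J (Pi\<^sub>E J F) \<inter> space (PiM I M)"
      then show "\<omega> \<in> {\<omega> \<in> space (PiM I M). \<forall>j\<in>J. \<omega> j \<in> f j -` F j \<inter> space (M j)}"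
        using J(2) by (auto simp: prod_emb_def space_PiM PiE_iff subset_iff)
    next
      fix \<omega> assume "\<omega> \<in> {\<omega> \<in> space (PiM I M). \<forall>j\<in>J. \<omega> j \<in> f j -` F j \<inter> space (M j)}"
      then show "\<omega> \<in> ?f -` prod_emb I M J (Pi\<^sub>E J F) \<inter> space (PiM I M)"
        using J(2) measurable_space[OF meas, of \<omega>]
        by (auto simp: prod_emb_def space_PiM PiE_iff subset_iff)
    qed
    also have "emeasure (PiM I M) \<dots> = (\<Prod>j\<in>J. emeasure (M j) (f j -` F j \<inter> space (M j)))"
      by (intro emeasure_PiM_Collect J pre)
    also have "\<dots> = (\<Prod>j\<in>J. emeasure (M j) (F j))"
    proof (intro prod.cong refl)
      fix j assume j: "j \<in> J"
      then have "emeasure (distr (M j) (M j) (f j)) (F j) = emeasure (M j) (f j -` F j \<inter> space (M j))"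
        using J(2) by (intro emeasure_distr f F) auto
      then show "emeasure (M j) (f j -` F j \<inter> space (M j)) = emeasure (M j) (F j)"
        using inv[of j] j J(2) by auto
    qed
    finally show "emeasure (distr (PiM I M) (PiM I M) ?f) (prod_emb I M J (Pi\<^sub>E J F))
        = (\<Prod>j\<in>J. emeasure (M j) (F j))" .
  qed simp
qed

lemma bij_betw_add_mod:
  fixes n a :: nat
  assumes "n > 0"
  shows "bij_betw (\<lambda>k. (k + a) mod n) {..<n} {..<n}"
proof -
  have "inj_on (\<lambda>k. (k + a) mod n) {..<n}"
  proof (rule inj_onI)
    fix k l assume kl: "k \<in> {..<n}" "l \<in> {..<n}" "(k + a) mod n = (l + a) mod n"
    then have "[k = l] (mod n)" by (metis cong_add_rcancel_nat cong_def)
    then show "k = l" using kl by (simp add: cong_def)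
  qed
  moreover have "(\<lambda>k. (k + a) mod n) ` {..<n} \<subseteq> {..<n}" using assms by auto
  ultimately show ?thesis by (simp add: bij_betw_def endo_inj_surj)
qed

lemma translate_preserving:
  "translate \<in> measurable residues residues" "distr residues residues translate = residues"
proof -
  have "distr (measure_pmf (pmf_of_set {..<p\<^sup>2})) (measure_pmf (pmf_of_set {..<p\<^sup>2})) (\<lambda>k. (k + (p\<^sup>2 - 1)) mod p\<^sup>2)
      = measure_pmf (pmf_of_set {..<p\<^sup>2})" if "prime p" for p :: nat
  proof -
    have p: "p\<^sup>2 > 0" using that by (simp add: prime_gt_0_nat)
    have "map_pmf (\<lambda>k. (k + (p\<^sup>2 - 1)) mod p\<^sup>2) (pmf_of_set {..<p\<^sup>2}) = pmf_of_set {..<p\<^sup>2}"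
      using p by (intro map_pmf_of_set_bij_betw bij_betw_add_mod) (auto simp: lessThan_empty_iff)
    then have "measure_pmf (map_pmf (\<lambda>k. (k + (p\<^sup>2 - 1)) mod p\<^sup>2) (pmf_of_set {..<p\<^sup>2})) = measure_pmf (pmf_of_set {..<p\<^sup>2})"
      by simp
    moreover have "distr (measure_pmf (pmf_of_set {..<p\<^sup>2})) (measure_pmf (pmf_of_set {..<p\<^sup>2})) (\<lambda>k. (k + (p\<^sup>2 - 1)) mod p\<^sup>2)
      = distr (measure_pmf (pmf_of_set {..<p\<^sup>2})) (count_space UNIV) (\<lambda>k. (k + (p\<^sup>2 - 1)) mod p\<^sup>2)"
      by (intro distr_cong) auto
    ultimately show ?thesis by (simp only: map_pmf_rep_eq)
  qed
  then show "translate \<in> measurable residues residues" "distr residues residues translate = residues"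
    unfolding residues_def translate_def
    by (intro distr_PiM_componentwise[where f="\<lambda>p k. (k + (p\<^sup>2 - 1)) mod p\<^sup>2"] measure_pmf.prob_space_axioms; simp)+
qed

lemma coins_shift_preserving:
  "left_shift \<in> measurable coins coins" "distr coins coins left_shift = coins"
proof -
  have eq: "(\<lambda>\<omega>. \<lambda>n\<in>UNIV. \<omega> (Suc n)) = left_shift"
    by (intro ext) (simp add: left_shift_def)
  show "left_shift \<in> measurable coins coins"
    unfolding eq[symmetric] coins_def
    by (intro measurable_restrict measurable_component_singleton) auto
  show "distr coins coins left_shift = coins"
    using distr_PiM_reindex[of UNIV "\<lambda>_. measure_pmf (bernoulli_pmf (1 / 2))" Suc UNIV]
    by (simp add: coins_def eq measure_pmf.prob_space_axioms)
qed

lemma sample_shift_preserving: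
  "sample_shift \<in> measurable sample sample" "distr sample sample sample_shift = sample"
proof -
  show "sample_shift \<in> measurable sample sample"
    unfolding sample_shift_def sample_def split_def
    using measurable_compose[OF measurable_fst translate_preserving(1)]
      measurable_compose[OF measurable_snd coins_shift_preserving(1)]
    by (intro measurable_Pair)
  interpret coins: prob_space coins by (rule prob_space_coins)
  show "distr sample sample sample_shift = sample"
    using pair_measure_distr[OF translate_preserving(1) coins_shift_preserving(1)]
    by (simp add: translate_preserving coins_shift_preserving sample_def sample_shift_def coins.sigma_finite_measure_axioms)
qed

lemma avoid_translate:
  assumes "Q \<subseteq> {p. prime p}"
  shows "n \<in> avoid Q (translate \<omega>) \<longleftrightarrow> Suc n \<in> avoid Q \<omega>"
proof -
  have "n mod p\<^sup>2 = translate \<omega> p mod p\<^sup>2 \<longleftrightarrow> Suc n mod p\<^sup>2 = \<omega> p mod p\<^sup>2" if "p \<in> Q" for p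
  proof -
    have p: "prime p" "p\<^sup>2 > 0" using that assms by (auto simp: prime_gt_0_nat)
    have "n mod p\<^sup>2 = translate \<omega> p mod p\<^sup>2 \<longleftrightarrow> [n = \<omega> p + (p\<^sup>2 - 1)] (mod p\<^sup>2)"
      using p by (simp add: translate_def cong_def)
    also have "\<dots> \<longleftrightarrow> [n + 1 = \<omega> p + (p\<^sup>2 - 1) + 1] (mod p\<^sup>2)"
      by (rule cong_add_rcancel_nat[symmetric])
    also have "\<omega> p + (p\<^sup>2 - 1) + 1 = \<omega> p + p\<^sup>2" using p by simp
    finally show ?thesis by (simp add: cong_def)
  qed
  then show ?thesis by (auto simp: avoid_def)
qed

lemma avoid_pred:
  assumes "Q \<subseteq> {p. prime p}"
  shows "Measurable.pred sample (\<lambda>z. n \<in> avoid Q (fst z))"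
proof -
  have "Measurable.pred sample (\<lambda>z. n mod p\<^sup>2 \<noteq> fst z p mod p\<^sup>2)" if "p \<in> Q" for p
  proof -
    have "(\<lambda>\<omega>. \<omega> p) \<in> measurable residues (measure_pmf (pmf_of_set {..<p\<^sup>2}))"
      unfolding residues_def using that assms by (intro measurable_component_singleton) auto
    then have "(\<lambda>z. fst z p) \<in> measurable sample (count_space UNIV)"
      unfolding sample_def by (intro measurable_compose[OF measurable_fst]) simp
    then show ?thesis by (rule measurable_compose) simp
  qed
  then have "Measurable.pred sample (\<lambda>z. \<forall>p\<in>Q. n mod p\<^sup>2 \<noteq> fst z p mod p\<^sup>2)"
    by (intro pred_intros_countable_bounded) auto
  then show ?thesis by (simp add: avoid_def)
qed

lemma coin_pred: "Measurable.pred sample (\<lambda>z. snd z n)"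
proof -
  have "(\<lambda>y. y n) \<in> measurable coins (measure_pmf (bernoulli_pmf (1 / 2)))"
    unfolding coins_def by (intro measurable_component_singleton) auto
  then have "(\<lambda>z. snd z n) \<in> measurable sample (count_space UNIV)"
    unfolding sample_def by (intro measurable_compose[OF measurable_snd]) simp
  then show ?thesis .
qed

lemma prob_avoid:
  assumes Q: "Q \<subseteq> {p. prime p}"
  shows "measure sample {z \<in> space sample. n \<in> avoid Q (fst z)} = measure sample {z \<in> space sample. 0 \<in> avoid Q (fst z)}"
proof (induction n)
  case (Suc n)
  have "measure sample {z \<in> space sample. n \<in> avoid Q (fst z)}
      = measure (distr sample sample sample_shift) {z \<in> space sample. n \<in> avoid Q (fst z)}"
    by (simp add: sample_shift_preserving)
  also have "\<dots> = measure sample (sample_shift -` {z \<in> space sample. n \<in> avoid Q (fst z)} \<inter> space sample)"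
    using avoid_pred[OF Q, of n] by (intro measure_distr sample_shift_preserving) (simp add: pred_def)
  also have "sample_shift -` {z \<in> space sample. n \<in> avoid Q (fst z)} \<inter> space sample
      = {z \<in> space sample. Suc n \<in> avoid Q (fst z)}"
  proof -
    have "n \<in> avoid Q (fst (sample_shift z)) \<longleftrightarrow> Suc n \<in> avoid Q (fst z)" for z
      by (simp add: sample_shift_def split_def avoid_translate[OF Q])
    then show ?thesis using measurable_space[OF sample_shift_preserving(1)] by blast
  qed
  finally show ?case using Suc by simp
qed simp

lemma expected_card_avoid:
  assumes Q: "Q \<subseteq> {p. prime p}"
  shows "(\<integral>z. real (card (avoid Q (fst z) \<inter> {..<n})) \<partial>sample)
    = n * measure sample {z \<in> space sample. 0 \<in> avoid Q (fst z)}"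
proof -
  have S: "{z \<in> space sample. i \<in> avoid Q (fst z)} \<in> sets sample" for i
    using avoid_pred[OF Q, of i] by (simp add: pred_def)
  have "(\<integral>z. real (card (avoid Q (fst z) \<inter> {..<n})) \<partial>sample)
      = (\<integral>z. (\<Sum>i<n. indicator {z \<in> space sample. i \<in> avoid Q (fst z)} z) \<partial>sample)"
  proof (intro Bochner_Integration.integral_cong refl)
    fix z assume z: "z \<in> space sample"
    have "(\<Sum>i<n. indicator {z \<in> space sample. i \<in> avoid Q (fst z)} z :: real) = (\<Sum>i<n. of_bool (i \<in> avoid Q (fst z)))"
      using z by (intro sum.cong) (auto simp: indicator_def)
    also have "\<dots> = real (card (avoid Q (fst z) \<inter> {..<n}))"
      by (simp add: of_bool_def sum.If_cases Int_commute)
    finally show "real (card (avoid Q (fst z) \<inter> {..<n})) = (\<Sum>i<n. indicator {z \<in> space sample. i \<in> avoid Q (fst z)} z)" ..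
  qed
  also have "\<dots> = (\<Sum>i<n. \<integral>z. indicator {z \<in> space sample. i \<in> avoid Q (fst z)} z \<partial>sample)"
    by (intro Bochner_Integration.integral_sum integrable_real_indicator S) (simp add: less_top[symmetric])
  also have "\<dots> = (\<Sum>i<n. measure sample {z \<in> space sample. i \<in> avoid Q (fst z)})"
    by (intro sum.cong refl) (simp add: Int_absorb2)
  also have "\<dots> = n * measure sample {z \<in> space sample. 0 \<in> avoid Q (fst z)}"
    by (subst prob_avoid[OF Q]) simp
  finally show ?thesis .
qed

text \<open>
  Its value is \<open>\<Prod> (1 - 1/p\<^sup>2) = 6/\<pi>\<^sup>2\<close>, the density of the squarefree integers; it is the limit
  of the densities of the sieved sets (\<open>pattern_density_tendsto\<close>).
\<close>

definition free_density :: real where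
  "free_density = measure sample {z \<in> space sample. 0 \<in> avoid {p. prime p} (fst z)}"

text \<open>
  For each choice of residues the avoiding positions form a translate of the sieved set, and hence fill the
  same number of places in a period. Averaging over the residues, and using that all positions are
  equally likely to avoid, gives the probability at position \<open>0\<close>.
\<close>

lemma pattern_density_eq_prob:
  "pattern_density K {0} = measure sample {z \<in> space sample. 0 \<in> avoid {p. prime p \<and> p \<le> K} (fst z)}"
proof -
  let ?Q = "{p. prime p \<and> p \<le> K}"
  have Q: "?Q \<subseteq> {p. prime p}" by auto
  have "real (card (avoid ?Q \<omega> \<inter> {..<period K})) = period K * pattern_density K {0}" for \<omega>
  proof -
    obtain r where r: "sieve K r = avoid ?Q \<omega>"
      using sieve_residues[of K \<omega>] by (auto simp: avoid_def)
    have "real (card (avoid ?Q \<omega> \<inter> {..<period K})) = (\<Sum>i<1 * period K. of_bool ((+) i ` {0} \<subseteq> sieve K r))"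
      by (simp add: r sum.If_cases of_bool_def Int_commute)
    also have "\<dots> = period K * pattern_density K {0}" by (subst pattern_count) simp
    finally show ?thesis .
  qed
  then have "period K * pattern_density K {0} = (\<integral>z. real (card (avoid ?Q (fst z) \<inter> {..<period K})) \<partial>sample)"
    by (simp add: sample.prob_space)
  also have "\<dots> = period K * measure sample {z \<in> space sample. 0 \<in> avoid ?Q (fst z)}"
    by (rule expected_card_avoid[OF Q])
  finally show ?thesis using period_pos[of K] by simp
qed

lemma pattern_density_tendsto: "(\<lambda>K. pattern_density K {0}) \<longlonglongrightarrow> free_density"
proof -
  let ?A = "\<lambda>K. {z \<in> space sample. 0 \<in> avoid {p. prime p \<and> p \<le> K} (fst z)}"
  have "(\<lambda>K. measure sample (?A K)) \<longlonglongrightarrow> measure sample (\<Inter>K. ?A K)"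
  proof (rule sample.finite_Lim_measure_decseq)
    show "range ?A \<subseteq> sets sample"
    proof (rule image_subsetI)
      fix K :: nat
      have "{p. prime p \<and> p \<le> K} \<subseteq> {p. prime p}" by auto
      from avoid_pred[OF this, of 0] show "?A K \<in> sets sample" by (simp add: pred_def)
    qed
    show "decseq ?A" by (auto simp: decseq_def avoid_def)
  qed
  also have "(\<Inter>K. ?A K) = {z \<in> space sample. 0 \<in> avoid {p. prime p} (fst z)}"
    by (auto simp: avoid_def)
  finally show ?thesis by (simp add: pattern_density_eq_prob free_density_def)
qed

section \<open>The randomly sieved measure\<close>

lemma sieved_in_flow: "sieved z \<in> squarefree_flow"
  unfolding squarefree_flow_residue by (intro exI[of _ "fst z"]) (auto simp: sieved_def avoid_def)

lemma measurable_borel_patterns: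
  assumes "\<And>j. Measurable.pred M (\<lambda>z. f z j)"
  shows "f \<in> measurable M (borel :: (nat \<Rightarrow> bool) measure)"
proof (rule measurable_sigma_sets[OF sets_borel_patterns])
  fix A :: "(nat \<Rightarrow> bool) set" assume "A \<in> {{x. \<forall>j\<in>F. x j} | F. finite F}"
  then obtain F where F: "finite F" "A = {x. \<forall>j\<in>F. x j}" by blast
  have "f -` A \<inter> space M = {z \<in> space M. \<forall>j\<in>F. f z j}" by (auto simp: F)
  also have "\<dots> \<in> sets M" using F(1) assms by (intro sets.sets_Collect_finite_All) (auto simp: pred_def)
  finally show "f -` A \<inter> space M \<in> sets M" .
qed auto

lemma sieved_measurable: "sieved \<in> measurable sample (restrict_space borel squarefree_flow)"
proof (rule measurable_restrict_space2)
  show "sieved \<in> measurable sample borel"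
  proof (rule measurable_borel_patterns)
    fix j
    have "Measurable.pred sample (\<lambda>z. j \<in> avoid {p. prime p} (fst z) \<and> snd z j)"
      by (intro pred_intros_logic avoid_pred coin_pred) auto
    then show "Measurable.pred sample (\<lambda>z. sieved z j)" by (simp add: sieved_def)
  qed
qed (auto simp: sieved_in_flow)

lemma left_shift_flow: "x \<in> squarefree_flow \<Longrightarrow> left_shift x \<in> squarefree_flow"
  unfolding squarefree_flow_residue
proof (elim exE)
  fix \<rho> assume \<rho>: "\<forall>p i. prime p \<longrightarrow> x i \<longrightarrow> i mod p\<^sup>2 \<noteq> \<rho> p mod p\<^sup>2"
  have "i mod p\<^sup>2 \<noteq> translate \<rho> p mod p\<^sup>2" if p: "prime p" and i: "left_shift x i" for p i
  proof -
    have "Suc i \<in> avoid {p} \<rho>" using \<rho> p i by (auto simp: avoid_def left_shift_def)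
    then have "i \<in> avoid {p} (translate \<rho>)" using avoid_translate[of "{p}" i \<rho>] p by auto
    then show ?thesis by (simp add: avoid_def)
  qed
  then show "\<exists>\<rho>. \<forall>p i. prime p \<longrightarrow> left_shift x i \<longrightarrow> i mod p\<^sup>2 \<noteq> \<rho> p mod p\<^sup>2" by blast
qed

lemma left_shift_measurable:
  "left_shift \<in> measurable (restrict_space borel squarefree_flow) (restrict_space borel squarefree_flow)"
proof (rule measurable_restrict_space3)
  show "left_shift \<in> measurable borel borel"
  proof (rule measurable_borel_patterns)
    fix j :: nat
    have "{x. \<forall>i\<in>{Suc j}. x i} \<in> sets (borel :: (nat \<Rightarrow> bool) measure)"
      by (intro borel_open open_pattern) simp
    then show "Measurable.pred borel (\<lambda>x. left_shift x j)" by (simp add: pred_def left_shift_def)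
  qed
qed (auto simp: left_shift_flow)

text \<open>
  The Mirsky measure of the squarefree numbers, thinned by fair coins; this is the measure of maximal entropy.
\<close>

definition sieved_law :: "(nat \<Rightarrow> bool) measure" where
  "sieved_law = distr sample (restrict_space borel squarefree_flow) sieved"

text \<open>
  Shifting the sequence amounts to shifting the coins and translating the residues, both of which preserve
  their laws; hence \<open>sieved_law\<close> is invariant.
\<close>

lemma left_shift_sieved: "left_shift (sieved z) = sieved (sample_shift z)"
proof
  fix n
  have "Suc n \<in> avoid {p. prime p} (fst z) \<longleftrightarrow> n \<in> avoid {p. prime p} (fst (sample_shift z))"
    by (simp add: sample_shift_def split_def avoid_translate)
  moreover have "snd (sample_shift z) n = snd z (Suc n)"
    by (simp add: sample_shift_def split_def left_shift_def)
  ultimately show "left_shift (sieved z) n = sieved (sample_shift z) n"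
    by (simp add: sieved_def left_shift_def)
qed

lemma sieved_law_invariant: "shift_invariant_measure squarefree_flow sieved_law"
proof
  let ?R = "restrict_space borel squarefree_flow"
  have sets: "sets sieved_law = sets ?R" by (simp add: sieved_law_def)
  have "prob_space sieved_law"
    unfolding sieved_law_def by (rule sample.prob_space_distr[OF sieved_measurable])
  moreover have "left_shift \<in> measurable sieved_law sieved_law"
    using left_shift_measurable by (simp add: measurable_cong_sets[OF sets sets])
  moreover have "distr sieved_law sieved_law left_shift = sieved_law"
  proof -
    have "distr sieved_law sieved_law left_shift = distr sieved_law ?R left_shift"
      by (intro distr_cong refl sets)
    also have "\<dots> = distr sample ?R (left_shift \<circ> sieved)"
      unfolding sieved_law_def by (rule distr_distr[OF left_shift_measurable sieved_measurable])
    also have "left_shift \<circ> sieved = sieved \<circ> sample_shift"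
      by (rule ext) (simp add: left_shift_sieved)
    also have "distr sample ?R (sieved \<circ> sample_shift) = distr (distr sample sample sample_shift) ?R sieved"
      by (rule distr_distr[OF sieved_measurable sample_shift_preserving(1), symmetric])
    finally show ?thesis by (simp add: sample_shift_preserving(2) sieved_law_def)
  qed
  ultimately show "invariant_borel_prob squarefree_flow left_shift sieved_law"
    using sets by (simp add: invariant_borel_prob_def)
qed

lemma prob_coins_eq:
  assumes "finite D"
  shows "measure coins {y \<in> space coins. \<forall>i\<in>D. y i = (i \<in> w)} = (1 / 2) ^ card D"
proof -
  have "emeasure coins {y \<in> space coins. \<forall>i\<in>D. y i \<in> {i \<in> w}}
      = (\<Prod>i\<in>D. emeasure (measure_pmf (bernoulli_pmf (1 / 2))) {i \<in> w})"
    unfolding coins_def by (intro coins.emeasure_PiM_Collect assms) auto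
  also have "\<dots> = (\<Prod>i\<in>D. ennreal (1 / 2))"
    by (intro prod.cong refl) (simp add: emeasure_pmf_single pmf_bernoulli_half)
  also have "\<dots> = ennreal ((1 / 2) ^ card D)"
    by (subst prod_ennreal) simp_all
  finally show ?thesis by (simp add: measure_def)
qed

lemma simple_function_finite_range:
  assumes "finite A" "\<And>x. x \<in> space M \<Longrightarrow> f x \<in> A" "\<And>a. a \<in> A \<Longrightarrow> {x \<in> space M. f x = a} \<in> sets M"
  shows "simple_function M f"
  unfolding simple_function_def
proof (intro conjI ballI)
  show "finite (f ` space M)" using assms(1,2) by (intro finite_subset[of "f ` space M" A]) auto
  fix a assume "a \<in> f ` space M"
  then have "{x \<in> space M. f x = a} \<in> sets M" using assms(2,3) by auto
  moreover have "f -` {a} \<inter> space M = {x \<in> space M. f x = a}" by auto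
  ultimately show "f -` {a} \<inter> space M \<in> sets M" by simp
qed

text \<open>
  Let \<open>D\<close> be the set of positions below \<open>n\<close> that avoid all residues and \<open>V\<close> the word. Given \<open>D\<close>, the word is
  uniform among the subsets of \<open>D\<close>, so \<open>H(D, V) = H(D) + E|D| ln 2\<close> exactly. Subadditivity bounds
  the left-hand side by \<open>H(D) + H(V)\<close>, and \<open>H(D)\<close> cancels.
\<close>

theorem entropy_sieved_law:
  "n * (free_density * ln 2) \<le> entropy_of sieved_law (word n)"
proof -
  interpret shift_invariant_measure squarefree_flow sieved_law by (rule sieved_law_invariant)
  define D where "D z = avoid {p. prime p} (fst z) \<inter> {..<n}" for z :: "(nat \<Rightarrow> nat) \<times> (nat \<Rightarrow> bool)"
  define V where "V z = word n (sieved z)" for z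
  have fin: "finite (Pow {..<n})" by simp
  have Dset: "{z \<in> space sample. D z = a} \<in> sets sample" if "a \<in> Pow {..<n}" for a
  proof -
    have "{z \<in> space sample. D z = a} = {z \<in> space sample. \<forall>i\<in>{..<n}. (i \<in> avoid {p. prime p} (fst z)) = (i \<in> a)}"
      using that by (auto simp: D_def)
    also have "\<dots> \<in> sets sample"
      using avoid_pred[of "{p. prime p}"] by measurable
    finally show ?thesis .
  qed
  have D: "simple_function sample D"
    by (rule simple_function_finite_range[OF fin _ Dset]) (auto simp: D_def)
  have wordR: "simple_function (restrict_space borel squarefree_flow) (word n)"
    using simple_word[of n] unfolding simple_function_def
    by (simp add: sieved_law_def space_distr)
  have V: "simple_function sample V"
    unfolding V_def[abs_def] by (rule simple_function_measurable_comp[OF wordR sieved_measurable])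
  have DV: "simple_function sample (\<lambda>z. (D z, V z))" by (intro simple_function_Pair D V)
  interpret coins: prob_space coins by (rule prob_space_coins)
  interpret residues: prob_space residues by (rule prob_space_residues)
  have joint: "fibre_prob sample (\<lambda>z. (D z, V z)) (a, w) = fibre_prob sample D a * (1 / 2) ^ card a"
    if aw: "a \<subseteq> {..<n}" "w \<subseteq> a" for a w
  proof -
    define A where "A = {\<omega> \<in> space residues. avoid {p. prime p} \<omega> \<inter> {..<n} = a}"
    define B where "B = {y \<in> space coins. \<forall>i\<in>a. y i = (i \<in> w)}"
    have fa: "finite a" using aw(1) finite_subset by blast
    have space: "space sample = space residues \<times> space coins" by (simp add: sample_def space_pair_measure)
    have D_A: "{z \<in> space sample. D z = a} = A \<times> space coins"
      by (intro set_eqI) (auto simp: space A_def D_def mem_Times_iff)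
    have "{z \<in> space sample. (D z, V z) = (a, w)} = A \<times> B"
    proof (intro set_eqI)
      fix z
      have "V z = w \<longleftrightarrow> (\<forall>i\<in>a. snd z i = (i \<in> w))" if "D z = a"
      proof -
        have "V z = {i \<in> a. snd z i}"
          unfolding that[symmetric] V_def D_def word_def sieved_def by blast
        then show ?thesis using aw(2) by blast
      qed
      moreover have "z \<in> A \<times> B \<longleftrightarrow> z \<in> space sample \<and> D z = a \<and> (\<forall>i\<in>a. snd z i = (i \<in> w))"
        by (auto simp: space A_def B_def D_def mem_Times_iff)
      ultimately show "z \<in> {z \<in> space sample. (D z, V z) = (a, w)} \<longleftrightarrow> z \<in> A \<times> B"
        by blast
    qed
    moreover have A: "A \<in> sets residues"
    proof -
      obtain y where y: "y \<in> space coins" using coins.not_empty by blast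
      have "(\<lambda>\<omega>. (\<omega>, y)) \<in> measurable residues sample" unfolding sample_def using y by simp
      then have "(\<lambda>\<omega>. (\<omega>, y)) -` {z \<in> space sample. D z = a} \<inter> space residues \<in> sets residues"
        using Dset aw(1) by (intro measurable_sets) auto
      also have "(\<lambda>\<omega>. (\<omega>, y)) -` {z \<in> space sample. D z = a} \<inter> space residues = A"
        unfolding D_A using y A_def by auto
      finally show ?thesis .
    qed
    moreover have B: "B \<in> sets coins"
    proof -
      have "(\<lambda>y. y i) \<in> measurable coins (count_space UNIV)" for i
        unfolding coins_def
        using measurable_component_singleton[of i UNIV "\<lambda>_. measure_pmf (bernoulli_pmf (1 / 2))"] by simp
      then have "Measurable.pred coins (\<lambda>y. y i)" for i .
      then show ?thesis unfolding B_def using fa by measurable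
    qed
    moreover have "measure sample (A \<times> C) = measure residues A * measure coins C" if "C \<in> sets coins" for C
      using coins.emeasure_pair_measure_Times[OF A that] by (simp add: sample_def measure_def enn2real_mult)
    ultimately show ?thesis
      using prob_coins_eq[OF fa, of w] by (simp add: fibre_prob_def D_A B_def coins.prob_space)
  qed
  have "entropy_of sample (\<lambda>z. (D z, V z))
      = (\<Sum>aw\<in>atoms sample (\<lambda>z. (D z, V z)). fibre_prob sample (\<lambda>z. (D z, V z)) aw
          * (- ln (fibre_prob sample D (fst aw)) + card (fst aw) * ln 2))"
    unfolding entropy_of_def sum_negf[symmetric]
  proof (intro sum.cong refl)
    fix aw assume aw: "aw \<in> atoms sample (\<lambda>z. (D z, V z))"
    then obtain z where z: "aw = (D z, V z)" by (auto simp: atoms_def)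
    (* given the set D z, each of its 2 ^ card (D z) subsets is equally likely *)
    have p: "fibre_prob sample (\<lambda>z. (D z, V z)) aw = fibre_prob sample D (D z) * (1 / 2) ^ card (D z)"
      unfolding z by (rule joint) (auto simp: D_def V_def word_def sieved_def)
    have "fibre_prob sample (\<lambda>z. (D z, V z)) aw > 0" using aw by (simp add: atoms_def)
    then have "fibre_prob sample D (D z) > 0" unfolding p by (simp add: zero_less_mult_iff)
    then have lnp: "ln (fibre_prob sample (\<lambda>z. (D z, V z)) aw) = ln (fibre_prob sample D (D z)) - card (D z) * ln 2"
      unfolding p by (simp add: ln_mult ln_realpow ln_div)
    then show "- (fibre_prob sample (\<lambda>z. (D z, V z)) aw * ln (fibre_prob sample (\<lambda>z. (D z, V z)) aw))
        = fibre_prob sample (\<lambda>z. (D z, V z)) aw * (- ln (fibre_prob sample D (fst aw)) + card (fst aw) * ln 2)"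
      unfolding lnp by (simp add: z algebra_simps)
  qed
  also have "\<dots> = (\<integral>z. - ln (fibre_prob sample D (D z)) + card (D z) * ln 2 \<partial>sample)"
    using sample.expectation_simple(2)[OF DV, of "\<lambda>aw. - ln (fibre_prob sample D (fst aw)) + card (fst aw) * ln 2"]
    by simp
  also have "\<dots> = (\<integral>z. - ln (fibre_prob sample D (D z)) \<partial>sample) + (\<integral>z. card (D z) * ln 2 \<partial>sample)"
    by (intro Bochner_Integration.integral_add
        sample.expectation_simple(1)[OF D, of "\<lambda>a. - ln (fibre_prob sample D a)"]
        sample.expectation_simple(1)[OF D, of "\<lambda>a. card a * ln 2"])
  also have "(\<integral>z. card (D z) * ln 2 \<partial>sample) = n * free_density * ln 2"
    using expected_card_avoid[of "{p. prime p}" n] by (simp add: D_def free_density_def)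
  also have "(\<integral>z. - ln (fibre_prob sample D (D z)) \<partial>sample) = entropy_of sample D"
    by (rule sample.entropy_of_eq_expectation[OF D, symmetric])
  finally have "entropy_of sample D + n * free_density * ln 2 \<le> entropy_of sample D + entropy_of sample V"
    using sample.entropy_of_pair_subadditive[OF D V] by simp
  moreover have "entropy_of sample V = entropy_of sieved_law (word n)"
    unfolding sieved_law_def V_def[abs_def] by (rule entropy_of_distr[OF sieved_measurable wordR, symmetric])
  ultimately show ?thesis by simp
qed

section \<open>Subcovers and words\<close>

lemma min_subcover_card_le:
  assumes "D \<subseteq> C" "finite D" "X \<subseteq> \<Union>D"
  shows "min_subcover_card X C \<le> card D"
  unfolding min_subcover_card_def by (rule Least_le) (use assms in blast)

lemma min_subcover_card_attained:
  assumes "\<exists>D\<subseteq>C. finite D \<and> X \<subseteq> \<Union>D"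
  shows "\<exists>D\<subseteq>C. finite D \<and> card D = min_subcover_card X C \<and> X \<subseteq> \<Union>D"
proof -
  have "\<exists>k. \<exists>D\<subseteq>C. finite D \<and> card D = k \<and> X \<subseteq> \<Union>D" using assms by blast
  then show ?thesis unfolding min_subcover_card_def by (rule LeastI_ex)
qed

text \<open>
  If \<open>A\<close> and \<open>B\<close> are subcovers of the joins of lengths \<open>m\<close> and \<open>n\<close>, then the sets \<open>a \<inter> T\<^sup>-\<^sup>m b\<close> form a subcover of
  the join of length \<open>m + n\<close>.
\<close>

lemma min_subcover_card_join_add:
  assumes T: "\<And>x. x \<in> X \<Longrightarrow> T x \<in> X"
    and fin: "\<And>n. \<exists>D\<subseteq>iterated_join X T C n. finite D \<and> X \<subseteq> \<Union>D"
  shows "min_subcover_card X (iterated_join X T C (m + n))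
    \<le> min_subcover_card X (iterated_join X T C m) * min_subcover_card X (iterated_join X T C n)"
proof -
  have Tm: "(T ^^ i) x \<in> X" if "x \<in> X" for i x by (induction i) (use that T in auto)
  obtain A where A: "A \<subseteq> iterated_join X T C m" "finite A"
      "card A = min_subcover_card X (iterated_join X T C m)" "X \<subseteq> \<Union>A"
    using min_subcover_card_attained[OF fin[of m]] by blast
  obtain B where B: "B \<subseteq> iterated_join X T C n" "finite B"
      "card B = min_subcover_card X (iterated_join X T C n)" "X \<subseteq> \<Union>B"
    using min_subcover_card_attained[OF fin[of n]] by blast
  define D where "D = (\<lambda>(a, b). a \<inter> (T ^^ m) -` b) ` (A \<times> B)"
  have "D \<subseteq> iterated_join X T C (m + n)"
  proof
    fix d assume "d \<in> D"
    then obtain a b where ab: "a \<in> A" "b \<in> B" "d = a \<inter> (T ^^ m) -` b" by (auto simp: D_def)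
    have "a \<in> iterated_join X T C m" using ab(1) A(1) by blast
    then obtain c where c: "a = X \<inter> (\<Inter>i<m. (T ^^ i) -` c i)" "\<forall>i<m. c i \<in> C"
      unfolding iterated_join_def by blast
    have "b \<in> iterated_join X T C n" using ab(2) B(1) by blast
    then obtain c' where c': "b = X \<inter> (\<Inter>i<n. (T ^^ i) -` c' i)" "\<forall>i<n. c' i \<in> C"
      unfolding iterated_join_def by blast
    define e where "e i = (if i < m then c i else c' (i - m))" for i
    have "d = X \<inter> (\<Inter>i<m + n. (T ^^ i) -` e i)"
    proof (intro set_eqI)
      fix x
      have "(\<forall>i<m + n. (T ^^ i) x \<in> e i) \<longleftrightarrow> (\<forall>i<m. (T ^^ i) x \<in> c i) \<and> (\<forall>i<n. (T ^^ i) ((T ^^ m) x) \<in> c' i)"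
      proof (intro iffI conjI allI impI)
        fix i assume all: "\<forall>i<m + n. (T ^^ i) x \<in> e i" and i: "i < n"
        have "(T ^^ (i + m)) x \<in> e (i + m)" using all i by simp
        then show "(T ^^ i) ((T ^^ m) x) \<in> c' i" by (simp add: e_def funpow_add)
      next
        fix i assume all: "\<forall>i<m + n. (T ^^ i) x \<in> e i" and i: "i < m"
        have "(T ^^ i) x \<in> e i" using all i by simp
        then show "(T ^^ i) x \<in> c i" using i by (simp add: e_def)
      next
        fix i assume all: "(\<forall>i<m. (T ^^ i) x \<in> c i) \<and> (\<forall>i<n. (T ^^ i) ((T ^^ m) x) \<in> c' i)" and i: "i < m + n"
        show "(T ^^ i) x \<in> e i"
        proof (cases "i < m")
          case False
          then have "(T ^^ (i - m)) ((T ^^ m) x) \<in> c' (i - m)" using all i by simp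
          moreover have "(T ^^ (i - m)) ((T ^^ m) x) = (T ^^ (i - m + m)) x" by (simp only: funpow_add comp_apply)
          ultimately show ?thesis using False by (simp add: e_def)
        qed (use all in \<open>simp add: e_def\<close>)
      qed
      then show "x \<in> d \<longleftrightarrow> x \<in> X \<inter> (\<Inter>i<m + n. (T ^^ i) -` e i)"
        unfolding ab(3) c(1) c'(1) using Tm[of x m] by auto
    qed
    moreover have "\<forall>i<m + n. e i \<in> C" using c(2) c'(2) by (auto simp: e_def)
    ultimately show "d \<in> iterated_join X T C (m + n)" unfolding iterated_join_def by blast
  qed
  moreover have "finite D" using A(2) B(2) by (simp add: D_def)
  moreover have "X \<subseteq> \<Union>D"
  proof
    fix x assume x: "x \<in> X"
    then obtain a b where "a \<in> A" "x \<in> a" "b \<in> B" "(T ^^ m) x \<in> b" using A(4) B(4) Tm by blast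
    then show "x \<in> \<Union>D" by (auto simp: D_def)
  qed
  ultimately have "min_subcover_card X (iterated_join X T C (m + n)) \<le> card D"
    by (rule min_subcover_card_le)
  also have "\<dots> \<le> card (A \<times> B)" unfolding D_def using A(2) B(2) by (intro card_image_le) simp
  finally show ?thesis using A(3) B(3) by (simp add: card_cartesian_product)
qed

lemma topological_entropy_cover_tendsto:
  assumes T: "\<And>x. x \<in> topspace X \<Longrightarrow> T x \<in> topspace X" and ne: "topspace X \<noteq> {}"
    and fin: "\<And>n. \<exists>D\<subseteq>iterated_join (topspace X) T C n. finite D \<and> topspace X \<subseteq> \<Union>D"
  shows "(\<lambda>n. ln (real (min_subcover_card (topspace X) (iterated_join (topspace X) T C n))) / real n)
    \<longlonglongrightarrow> topological_entropy_cover X T C"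
  unfolding topological_entropy_cover_def
proof (rule fekete(1))
  let ?N = "\<lambda>n. min_subcover_card (topspace X) (iterated_join (topspace X) T C n)"
  have pos: "?N n > 0" for n
  proof -
    obtain D where "finite D" "card D = ?N n" "topspace X \<subseteq> \<Union>D"
      using min_subcover_card_attained[OF fin[of n]] by blast
    then show ?thesis using ne by (metis Union_empty card_gt_0_iff subset_empty)
  qed
  fix m n
  have "ln (real (?N (m + n))) \<le> ln (real (?N m * ?N n))"
    using min_subcover_card_join_add[OF T fin, of m n] pos[of "m + n"]
    by (intro ln_mono) (simp_all only: of_nat_le_iff of_nat_0_less_iff)
  then show "ln (real (?N (m + n))) \<le> ln (real (?N m)) + ln (real (?N n))"
    using pos[of m] pos[of n] by (simp add: ln_mult)
  show "0 \<le> ln (real (?N n))" using pos[of n] by simp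
qed

lemma closed_squarefree_flow: "closed squarefree_flow"
proof -
  have closed: "closed {x :: nat \<Rightarrow> bool. \<not> x i}" for i
  proof -
    have "open {x :: nat \<Rightarrow> bool. \<forall>j\<in>{i}. x j}" by (rule open_pattern) simp
    then show ?thesis by (simp add: closed_def Compl_eq)
  qed
  have "squarefree_flow = (\<Inter>p\<in>{p. prime p}. \<Union>b\<in>{..<p\<^sup>2}. \<Inter>i\<in>{i. i mod p\<^sup>2 = b}. {x. \<not> x i})"
  proof (intro set_eqI iffI)
    fix x assume "x \<in> squarefree_flow"
    then obtain \<rho> where \<rho>: "\<And>p i. prime p \<Longrightarrow> x i \<Longrightarrow> i mod p\<^sup>2 \<noteq> \<rho> p mod p\<^sup>2"
      by (auto simp: squarefree_flow_residue)
    show "x \<in> (\<Inter>p\<in>{p. prime p}. \<Union>b\<in>{..<p\<^sup>2}. \<Inter>i\<in>{i. i mod p\<^sup>2 = b}. {x. \<not> x i})"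
    proof (rule INT_I)
      fix p :: nat assume "p \<in> {p. prime p}"
      then have p: "prime p" by simp
      show "x \<in> (\<Union>b\<in>{..<p\<^sup>2}. \<Inter>i\<in>{i. i mod p\<^sup>2 = b}. {x. \<not> x i})"
      proof (rule UN_I)
        show "\<rho> p mod p\<^sup>2 \<in> {..<p\<^sup>2}" using p by (simp add: prime_gt_0_nat)
        show "x \<in> (\<Inter>i\<in>{i. i mod p\<^sup>2 = \<rho> p mod p\<^sup>2}. {x. \<not> x i})" using \<rho>[OF p] by blast
      qed
    qed
  next
    fix x :: "nat \<Rightarrow> bool"
    assume x: "x \<in> (\<Inter>p\<in>{p. prime p}. \<Union>b\<in>{..<p\<^sup>2}. \<Inter>i\<in>{i. i mod p\<^sup>2 = b}. {x. \<not> x i})"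
    have "\<forall>p. \<exists>b. prime p \<longrightarrow> (\<forall>i. x i \<longrightarrow> i mod p\<^sup>2 \<noteq> b mod p\<^sup>2)"
    proof
      fix p :: nat
      show "\<exists>b. prime p \<longrightarrow> (\<forall>i. x i \<longrightarrow> i mod p\<^sup>2 \<noteq> b mod p\<^sup>2)"
      proof (cases "prime p")
        case True
        then have "x \<in> (\<Union>b\<in>{..<p\<^sup>2}. \<Inter>i\<in>{i. i mod p\<^sup>2 = b}. {x. \<not> x i})" using x by blast
        then obtain b where b: "b < p\<^sup>2" "\<forall>i. i mod p\<^sup>2 = b \<longrightarrow> \<not> x i" by blast
        have "b mod p\<^sup>2 = b" using b(1) by (rule mod_less)
        then show ?thesis using b(2) by (intro exI[of _ b]) metis
      qed simp
    qed
    from choice[OF this] show "x \<in> squarefree_flow" unfolding squarefree_flow_residue by blast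
  qed
  moreover have "closed (\<Inter>p\<in>{p. prime p}. \<Union>b\<in>{..<p\<^sup>2}. \<Inter>i\<in>{i. i mod p\<^sup>2 = b}. {x :: nat \<Rightarrow> bool. \<not> x i})"
    by (intro closed_INT closed_UN ballI closed) auto
  ultimately show ?thesis by simp
qed

lemma compact_squarefree_flow: "compact squarefree_flow"
proof -
  have "compact_space (euclidean :: bool topology)"
    by (simp add: compact_space_def finite_imp_compact)
  then have "compact_space (product_topology (\<lambda>_ :: nat. euclidean :: bool topology) UNIV)"
    by (simp add: compact_space_product_topology)
  then have "compact (UNIV :: (nat \<Rightarrow> bool) set)"
    by (simp add: euclidean_product_topology compact_space_def)
  from compact_Int_closed[OF this closed_squarefree_flow] show ?thesis by simp
qed

lemma open_cylinder: "open {y. word n y = word n x}"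
proof -
  have "open {y :: nat \<Rightarrow> bool. \<forall>i\<in>{..<n}. y i \<in> {x i}}"
    by (rule product_topology_basis'[of "{..<n}" "\<lambda>i. {x i}" "\<lambda>j. j"])
      (rule finite_lessThan discrete_topology_class.open_discrete)+
  moreover have "word n y = word n x \<longleftrightarrow> (\<forall>i\<in>{..<n}. y i \<in> {x i})" for y
    unfolding word_eq_iff by blast
  ultimately show ?thesis by simp
qed

text \<open>
  A Lebesgue number for the cover, with cylinders of length \<open>m\<close> in place of balls of a fixed radius.
\<close>

lemma cylinders_refine_open_cover:
  assumes X: "compact X" and C: "open_cover (top_of_set X) C"
  shows "\<exists>m. \<forall>x\<in>X. \<exists>U\<in>C. {y \<in> X. word m y = word m x} \<subseteq> U"
proof -
  have "\<forall>x\<in>X. \<exists>n. \<exists>U\<in>C. {y \<in> X. word n y = word n x} \<subseteq> U"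
  proof
    fix x assume x: "x \<in> X"
    then have "x \<in> \<Union>C" using C by (simp add: open_cover_def)
    then obtain U where U: "U \<in> C" "x \<in> U" by blast
    then have "openin (top_of_set X) U" using C by (simp add: open_cover_def)
    then obtain V where V: "open V" "U = X \<inter> V" unfolding openin_open by blast
    then obtain n where "\<forall>y. word n y = word n x \<longrightarrow> y \<in> V" using open_contains_cylinder[of V x] U(2) by blast
    then have "{y \<in> X. word n y = word n x} \<subseteq> U" unfolding V(2) by blast
    then show "\<exists>n. \<exists>U\<in>C. {y \<in> X. word n y = word n x} \<subseteq> U" using U(1) by blast
  qed
  from bchoice[OF this] obtain n where n: "\<forall>x\<in>X. \<exists>U\<in>C. {y \<in> X. word (n x) y = word (n x) x} \<subseteq> U" ..
  have opens: "open {y. word (n x) y = word (n x) x}" if "x \<in> X" for x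
    by (rule open_cylinder)
  have cover: "X \<subseteq> (\<Union>x\<in>X. {y. word (n x) y = word (n x) x})" by blast
  obtain Y where Y: "Y \<subseteq> X" "finite Y" "X \<subseteq> (\<Union>x\<in>Y. {y. word (n x) y = word (n x) x})"
    by (rule compactE_image[where f="\<lambda>x. {y. word (n x) y = word (n x) x}", OF X opens cover])
  define m where "m = (\<Sum>x\<in>Y. n x)"
  show ?thesis
  proof (intro exI[of _ m] ballI)
    fix x assume x: "x \<in> X"
    then obtain z where z: "z \<in> Y" "word (n z) x = word (n z) z" using Y(3) by blast
    have "n z \<le> m" unfolding m_def using z(1) Y(2) by (intro member_le_sum) auto
    have "word (n z) y = word (n z) z" if "word m y = word m x" for y
      using that word_prefix[OF \<open>n z \<le> m\<close>, of y] word_prefix[OF \<open>n z \<le> m\<close>, of x] z(2) by simp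
    then have "{y \<in> X. word m y = word m x} \<subseteq> {y \<in> X. word (n z) y = word (n z) z}"
      by blast
    moreover have "z \<in> X" using z(1) Y(1) by blast
    from bspec[OF n this] obtain U where U: "U \<in> C" "{y \<in> X. word (n z) y = word (n z) z} \<subseteq> U" ..
    ultimately show "\<exists>U\<in>C. {y \<in> X. word m y = word m x} \<subseteq> U"
      by (intro bexI[OF _ U(1)] order_trans[OF _ U(2)])
  qed
qed

text \<open>
  A word of length \<open>n + m\<close> determines the words of length \<open>m\<close> at the times \<open>i < n\<close>, and each of these picks a
  member of \<open>C\<close> that contains the shifted point.
\<close>

lemma join_subcover_by_words:
  assumes X: "\<And>x. x \<in> X \<Longrightarrow> left_shift x \<in> X"
    and m: "\<forall>x\<in>X. \<exists>U\<in>C. {y \<in> X. word m y = word m x} \<subseteq> U"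
  shows "\<exists>D\<subseteq>iterated_join X left_shift C n. finite D \<and> X \<subseteq> \<Union>D \<and> card D \<le> card (word (n + m) ` X)"
proof -
  have Xi: "(left_shift ^^ i) x \<in> X" if "x \<in> X" for i x by (induction i) (use that X in auto)
  have "\<forall>x\<in>X. \<exists>U. U \<in> C \<and> {y \<in> X. word m y = word m x} \<subseteq> U" using m by (simp only: Bex_def)
  from bchoice[OF this] obtain u
    where u': "\<forall>x\<in>X. u x \<in> C \<and> {y \<in> X. word m y = word m x} \<subseteq> u x" ..
  have u: "u x \<in> C" "{y \<in> X. word m y = word m x} \<subseteq> u x" if "x \<in> X" for x
    using bspec[OF u' that] by (rule conjunct1, rule conjunct2)
  (* the sets picked for a word are those picked for a representative point with that word *)
  define rep where "rep v = (SOME x. x \<in> X \<and> word (n + m) x = v)" for v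
  have rep: "rep v \<in> X \<and> word (n + m) (rep v) = v" if "v \<in> word (n + m) ` X" for v
  proof -
    have "\<exists>x. x \<in> X \<and> word (n + m) x = v" using that by blast
    then show ?thesis unfolding rep_def by (rule someI_ex)
  qed
  define E where "E v = X \<inter> (\<Inter>i<n. (left_shift ^^ i) -` u ((left_shift ^^ i) (rep v)))" for v
  let ?D = "E ` word (n + m) ` X"
  have "?D \<subseteq> iterated_join X left_shift C n"
  proof
    fix d assume "d \<in> ?D"
    then obtain v where v: "v \<in> word (n + m) ` X" "d = E v" by blast
    have "rep v \<in> X" using rep[OF v(1)] by (rule conjunct1)
    then have "\<forall>i<n. u ((left_shift ^^ i) (rep v)) \<in> C" by (intro allI impI u(1) Xi)
    then show "d \<in> iterated_join X left_shift C n"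
      unfolding iterated_join_def v(2) E_def
      by (intro CollectI exI[of _ "\<lambda>i. u ((left_shift ^^ i) (rep v))"] conjI refl)
  qed
  moreover have "X \<subseteq> \<Union>?D"
  proof
    fix x assume x: "x \<in> X"
    let ?v = "word (n + m) x"
    have v: "?v \<in> word (n + m) ` X" using x by blast
    have "(left_shift ^^ i) x \<in> u ((left_shift ^^ i) (rep ?v))" if i: "i < n" for i
    proof -
      have "word (n + m) (rep ?v) = word (n + m) x" using rep[OF v] by (rule conjunct2)
      then have "\<forall>k<n + m. rep ?v k = x k" by (simp only: word_eq_iff)
      then have "word m ((left_shift ^^ i) x) = word m ((left_shift ^^ i) (rep ?v))"
        unfolding word_eq_iff funpow_left_shift using i by simp
      then have "(left_shift ^^ i) x \<in> {y \<in> X. word m y = word m ((left_shift ^^ i) (rep ?v))}"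
        using Xi[OF x] by simp
      then show ?thesis using subsetD[OF u(2)[OF Xi[OF conjunct1[OF rep[OF v]]]]] by blast
    qed
    then have "x \<in> E ?v" using x by (simp add: E_def)
    then show "x \<in> \<Union>?D" using v by blast
  qed
  ultimately show ?thesis
    by (intro exI[of _ ?D] conjI) (simp_all add: finite_words card_image_le)
qed

lemma squarefree_flow_nonempty: "{x \<in> squarefree_flow. x 0} \<noteq> {}" "{x \<in> squarefree_flow. \<not> x 0} \<noteq> {}"
proof -
  have "0 mod p\<^sup>2 \<noteq> 1 mod p\<^sup>2" if "prime p" for p :: nat
    using prime_gt_Suc_0_nat[OF that] by simp
  then have "(\<lambda>i. i = 0) \<in> squarefree_flow"
    unfolding squarefree_flow_residue by (intro exI[of _ "\<lambda>_. 1"]) blast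
  then show "{x \<in> squarefree_flow. x 0} \<noteq> {}" by blast
  have "(\<lambda>_. False) \<in> squarefree_flow" by (simp add: squarefree_flow_residue)
  then show "{x \<in> squarefree_flow. \<not> x 0} \<noteq> {}" by blast
qed

section \<open>Topological entropy, and the theorem\<close>

lemma ln_card_words_ge: "n * (free_density * ln 2) \<le> ln (card (word n ` squarefree_flow))"
proof -
  interpret shift_invariant_measure squarefree_flow sieved_law by (rule sieved_law_invariant)
  have "atoms sieved_law (word n) \<subseteq> word n ` squarefree_flow" by (auto simp: atoms_def space_eq)
  then have "entropy_of sieved_law (word n) \<le> ln (card (word n ` squarefree_flow))"
    by (intro entropy_of_le_ln_card simple_word finite_words)
  with entropy_sieved_law[of n] show ?thesis by linarith
qed

text \<open>
  Both entropies of the flow are growth rates dominated by the logarithm of the number of words; the bound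
  holds with every \<open>pattern_density K {0}\<close>, hence with their limit.
\<close>

lemma limit_of_word_rate_le:
  assumes lim: "(\<lambda>n. a n / real n) \<longlonglongrightarrow> l"
    and le: "\<And>n. a n \<le> ln (card (word (n + m) ` squarefree_flow))"
  shows "l \<le> free_density * ln 2"
proof -
  have "l \<le> pattern_density K {0} * ln 2" for K
  proof -
    let ?d = "pattern_density K {0} * ln 2"
    define c where "c = ln (period K) + (real m * pattern_density K {0} + period K) * ln 2"
    have "a n / n \<le> c / n + ?d" if "n > 0" for n
    proof -
      have "a n \<le> c + n * ?d"
        using le[of n] ln_card_words_le[of "n + m" K] by (simp add: c_def algebra_simps)
      then show ?thesis using that by (simp add: field_simps)
    qed
    moreover have "(\<lambda>n. c / real n + ?d) \<longlonglongrightarrow> 0 + ?d"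
      by (intro tendsto_add lim_const_over_n tendsto_const)
    ultimately have "l \<le> 0 + ?d"
      by (intro LIMSEQ_le[OF lim]) (auto intro!: exI[of _ 1])
    then show ?thesis by simp
  qed
  moreover have lim_density: "(\<lambda>K. pattern_density K {0} * ln 2) \<longlonglongrightarrow> free_density * ln 2"
    by (intro tendsto_mult_right pattern_density_tendsto)
  ultimately show ?thesis by (intro LIMSEQ_le_const[OF lim_density]) auto
qed

lemma flow_subcover:
  assumes C: "open_cover (top_of_set squarefree_flow) C"
  shows "\<exists>m. \<forall>n. \<exists>D\<subseteq>iterated_join squarefree_flow left_shift C n. finite D \<and> squarefree_flow \<subseteq> \<Union>D
      \<and> card D \<le> card (word (n + m) ` squarefree_flow)"
proof -
  obtain m where m: "\<forall>x\<in>squarefree_flow. \<exists>U\<in>C. {y \<in> squarefree_flow. word m y = word m x} \<subseteq> U"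
    using cylinders_refine_open_cover[OF compact_squarefree_flow C] by (elim exE)
  show ?thesis by (intro exI[of _ m] allI join_subcover_by_words[OF left_shift_flow m])
qed

lemma flow_cover_entropy_tendsto:
  assumes C: "open_cover (top_of_set squarefree_flow) C"
  shows "(\<lambda>n. ln (real (min_subcover_card squarefree_flow (iterated_join squarefree_flow left_shift C n))) / real n)
    \<longlonglongrightarrow> topological_entropy_cover (top_of_set squarefree_flow) left_shift C"
proof -
  obtain m where m: "\<forall>n. \<exists>D\<subseteq>iterated_join squarefree_flow left_shift C n. finite D \<and> squarefree_flow \<subseteq> \<Union>D
      \<and> card D \<le> card (word (n + m) ` squarefree_flow)"
    using flow_subcover[OF C] by (elim exE)
  have fin: "\<exists>D\<subseteq>iterated_join squarefree_flow left_shift C n. finite D \<and> squarefree_flow \<subseteq> \<Union>D" for n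
    using spec[OF m, of n] by blast
  have ne: "squarefree_flow \<noteq> {}" using squarefree_flow_nonempty by blast
  show ?thesis
    using topological_entropy_cover_tendsto[of "top_of_set squarefree_flow" left_shift C] left_shift_flow ne fin
    unfolding topspace_euclidean_subtopology by blast
qed

lemma topological_entropy_squarefree_flow_le:
  "topological_entropy (top_of_set squarefree_flow) left_shift \<le> ereal (free_density * ln 2)"
  unfolding topological_entropy_def
proof (rule SUP_least)
  fix C :: "(nat \<Rightarrow> bool) set set" assume "C \<in> {C. open_cover (top_of_set squarefree_flow) C}"
  then have C: "open_cover (top_of_set squarefree_flow) C" by simp
  let ?N = "\<lambda>n. min_subcover_card squarefree_flow (iterated_join squarefree_flow left_shift C n)"
  obtain m where m: "\<forall>n. \<exists>D\<subseteq>iterated_join squarefree_flow left_shift C n. finite D \<and> squarefree_flow \<subseteq> \<Union>D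
      \<and> card D \<le> card (word (n + m) ` squarefree_flow)"
    using flow_subcover[OF C] by (elim exE)
  have "ln (real (?N n)) \<le> ln (card (word (n + m) ` squarefree_flow))" for n
  proof -
    obtain D where D: "D \<subseteq> iterated_join squarefree_flow left_shift C n" "finite D"
        "squarefree_flow \<subseteq> \<Union>D" "card D \<le> card (word (n + m) ` squarefree_flow)"
      using spec[OF m, of n] by blast
    have "?N n \<le> card (word (n + m) ` squarefree_flow)"
      using min_subcover_card_le[OF D(1-3)] D(4) by (rule order_trans)
    moreover have "card (word (n + m) ` squarefree_flow) > 0"
      using squarefree_flow_nonempty by (auto simp: card_gt_0_iff finite_words)
    ultimately show ?thesis by (cases "?N n = 0") (auto intro!: ln_mono)
  qed
  from limit_of_word_rate_le[OF flow_cover_entropy_tendsto[OF C] this]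
  show "ereal (topological_entropy_cover (top_of_set squarefree_flow) left_shift C) \<le> ereal (free_density * ln 2)"
    by simp
qed

text \<open>
  For the cover according to the first coordinate, points of one cell of the join have the same
  word, so a subcover has at least as many members as there are words.
\<close>

lemma topological_entropy_squarefree_flow_ge:
  "ereal (free_density * ln 2) \<le> topological_entropy (top_of_set squarefree_flow) left_shift"
proof -
  define C where "C = {{x \<in> squarefree_flow. x 0}, {x \<in> squarefree_flow. \<not> x 0}}"
  let ?J = "iterated_join squarefree_flow left_shift C"
  have C: "open_cover (top_of_set squarefree_flow) C"
  proof -
    have "word 1 y = word 1 (\<lambda>_. True) \<longleftrightarrow> y 0" "word 1 y = word 1 (\<lambda>_. False) \<longleftrightarrow> \<not> y 0" for y
      unfolding word_eq_iff by simp_all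
    then have opens: "open {y :: nat \<Rightarrow> bool. y 0}" "open {y :: nat \<Rightarrow> bool. \<not> y 0}"
      using open_cylinder[of 1 "\<lambda>_. True"] open_cylinder[of 1 "\<lambda>_. False"] by simp_all
    have op: "openin (top_of_set squarefree_flow) (squarefree_flow \<inter> {x. x 0})"
      "openin (top_of_set squarefree_flow) (squarefree_flow \<inter> {x. \<not> x 0})"
      by (rule openin_open_Int[OF opens(1)], rule openin_open_Int[OF opens(2)])
    have C_eq: "C = {squarefree_flow \<inter> {x. x 0}, squarefree_flow \<inter> {x. \<not> x 0}}"
      unfolding C_def by blast
    have "openin (top_of_set squarefree_flow) U" if "U \<in> C" for U
      using that op unfolding C_eq by blast
    moreover have "\<Union>C = squarefree_flow" unfolding C_eq by blast
    ultimately show ?thesis by (simp add: open_cover_def)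
  qed
  have same: "word n x = word n y" if A: "A \<in> ?J n" "x \<in> A" "y \<in> A" for A n x y
    unfolding word_eq_iff
  proof (intro allI impI)
    fix i assume i: "i < n"
    obtain c where c: "A = squarefree_flow \<inter> (\<Inter>i<n. (left_shift ^^ i) -` c i)" "\<forall>i<n. c i \<in> C"
      using A(1) unfolding iterated_join_def by (elim CollectE exE conjE)
    have mem: "(left_shift ^^ i) x \<in> c i" "(left_shift ^^ i) y \<in> c i"
      using A(2,3) i unfolding c(1) by simp_all
    have "c i = {x \<in> squarefree_flow. x 0} \<or> c i = {x \<in> squarefree_flow. \<not> x 0}"
      using c(2) i unfolding C_def by simp
    then show "x i = y i"
    proof
      assume "c i = {x \<in> squarefree_flow. x 0}"
      with mem show ?thesis by (simp add: funpow_left_shift)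
    next
      assume "c i = {x \<in> squarefree_flow. \<not> x 0}"
      with mem show ?thesis by (simp add: funpow_left_shift)
    qed
  qed
  have count: "card (word n ` squarefree_flow) \<le> min_subcover_card squarefree_flow (?J n)" for n
  proof -
    obtain m where m: "\<forall>n. \<exists>D\<subseteq>?J n. finite D \<and> squarefree_flow \<subseteq> \<Union>D \<and> card D \<le> card (word (n + m) ` squarefree_flow)"
      using flow_subcover[OF C] by (elim exE)
    from spec[OF m, of n] have "\<exists>D\<subseteq>?J n. finite D \<and> squarefree_flow \<subseteq> \<Union>D" by blast
    from min_subcover_card_attained[OF this] obtain D where D: "D \<subseteq> ?J n" "finite D" "card D = min_subcover_card squarefree_flow (?J n)"
        "squarefree_flow \<subseteq> \<Union>D"
      by (elim exE conjE)
    define g where "g A = word n (SOME x. x \<in> A)" for A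
    have "word n ` squarefree_flow \<subseteq> g ` D"
    proof
      fix w assume "w \<in> word n ` squarefree_flow"
      then obtain x A where x: "w = word n x" "x \<in> A" "A \<in> D" using D(4) by blast
      have chosen: "(SOME x. x \<in> A) \<in> A" by (rule someI[of "\<lambda>x. x \<in> A", OF x(2)])
      have "A \<in> ?J n" using x(3) D(1) by (rule subsetD[rotated])
      then have "g A = w" unfolding g_def x(1) using chosen x(2) by (rule same)
      then show "w \<in> g ` D" using x(3) by blast
    qed
    then have "card (word n ` squarefree_flow) \<le> card D" using D(2) by (rule surj_card_le[rotated])
    then show ?thesis using D(3) by simp
  qed
  have "free_density * ln 2 \<le> ln (real (min_subcover_card squarefree_flow (?J n))) / n" if n: "n > 0" for n
  proof -
    have "card (word n ` squarefree_flow) > 0"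
      using squarefree_flow_nonempty by (auto simp: card_gt_0_iff finite_words)
    then have "ln (card (word n ` squarefree_flow)) \<le> ln (real (min_subcover_card squarefree_flow (?J n)))"
      using count[of n] by (intro ln_mono) auto
    then show ?thesis using ln_card_words_ge[of n] n by (simp add: field_simps)
  qed
  then have "free_density * ln 2 \<le> topological_entropy_cover (top_of_set squarefree_flow) left_shift C"
    by (intro LIMSEQ_le_const[OF flow_cover_entropy_tendsto[OF C]] exI[of _ 1]) auto
  also have "ereal (topological_entropy_cover (top_of_set squarefree_flow) left_shift C)
      \<le> topological_entropy (top_of_set squarefree_flow) left_shift"
    unfolding topological_entropy_def using C by (intro SUP_upper) simp
  finally show ?thesis by simp
qed

theorem topological_entropy_squarefree_flow:
  "topological_entropy (top_of_set squarefree_flow) left_shift = ereal (free_density * ln 2)"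
  using topological_entropy_squarefree_flow_le topological_entropy_squarefree_flow_ge by (rule antisym)

theorem theorem1p1:
  "\<exists>!M. maximal_entropy_measure squarefree_flow left_shift M"
proof (rule ex1I)
  interpret shift_invariant_measure squarefree_flow sieved_law by (rule sieved_law_invariant)
  have "entropy_of sieved_law (word n) \<le> ln (card (word (n + 0) ` squarefree_flow))" for n
    by (intro entropy_of_le_ln_card simple_word) (auto simp: atoms_def space_eq finite_words)
  then have le: "word_entropy \<le> free_density * ln 2"
    by (rule limit_of_word_rate_le[OF word_entropy_tendsto])
  have "free_density * ln 2 \<le> entropy_of sieved_law (word n) / n" if "n > 0" for n
    using entropy_sieved_law[of n] that by (simp add: field_simps)
  then have ge: "free_density * ln 2 \<le> word_entropy"
    by (intro LIMSEQ_le_const[OF word_entropy_tendsto] exI[of _ 1]) auto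
  have "measure_entropy sieved_law left_shift = ereal (free_density * ln 2)"
    using measure_entropy_le measure_entropy_ge[OF squarefree_flow_nonempty] le ge by simp
  then show "maximal_entropy_measure squarefree_flow left_shift sieved_law"
    by (simp add: maximal_entropy_measure_def inv topological_entropy_squarefree_flow)
  fix M assume M: "maximal_entropy_measure squarefree_flow left_shift M"
  interpret M: shift_invariant_measure squarefree_flow M
    using M by unfold_locales (simp add: maximal_entropy_measure_def)
  have "ereal (free_density * ln 2) \<le> ereal M.word_entropy"
    using M M.measure_entropy_le by (simp add: maximal_entropy_measure_def topological_entropy_squarefree_flow)
  then have "free_density * ln 2 \<le> M.word_entropy" by simp
  then show "M = sieved_law"
    using ge by (intro max_entropy_unique[where h="free_density * ln 2"] M.shift_invariant_measure_axioms
        shift_invariant_measure_axioms tendsto_mult_right pattern_density_tendsto)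
qed

end
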